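(* Let $(D_\lambda)_{\lambda\in\Lambda}$ be a family of Prüfer domains, $R=\prod_{\lambda\in\Lambda}D_\lambda$, $X=\dot\bigcup_{\lambda\in\Lambda}\max(D_\lambda)$, and let $\mathcal{U}$ be an ultrafilter on $X$ (equivalently, in the Boolean algebra $\prod_\lambda\mathcal{P}(\max(D_\lambda))$). (1) The injective homomorphism \[R^*\to\prod\nolimits^{\mathcal{U}}_{M\in X}(D_\lambda)_M,\qquad r^*\mapsto(r_\lambda)^{\mathcal{U}}_{M\in X}\] canonically extends to an injective homomorphism \[R^*_{\mathcal{U}}\to\prod\nolimits^{\mathcal{U}}_{M\in X}(D_\lambda)_M\] via localization. (2) The map \[v:K^*\setminus\{0\}\to\Gamma_{\mathcal{U}}:=\prod\nolimits^{\mathcal{U}}_{M\in X}\Gamma_M,\qquad(k_\lambda)_\lambda^{\mathcal{F}_{\mathcal{U}}}\mapsto(v_M(k_\lambda))^{\mathcal{U}}_M\] is a valuation on $K^*$ with valuation ring $R^*_{\mathcal{U}}$. (3) For $a,b\in R$, the following assertions are equivalent: (a) $v(a^* )\geq v(b^* )$. (b) $\{M\in X\mid v_M(a_\lambda)\geq v_M(b_\lambda)\}\in\mathcal{U}$.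
   Context: $\max(D)$ is the set of maximal ideals of $D$. For $M\in X$ (disjoint union), $\lambda$ denotes the index with $M\in\max(D_\lambda)$. $\prod^{\mathcal{F}}$ denotes an ultraproduct with respect to the ultrafilter $\mathcal{F}$. Subsets of $X$ correspond to elements of $\prod_\lambda\mathcal{P}(\max(D_\lambda))$ via $(V_\lambda)_\lambda\mapsto\dot\bigcup_\lambda V_\lambda$. $\mathcal{F}_{\mathcal{U}}=\{F_U\mid U\in\mathcal{U}\}$ with $F_U=\{\lambda\in\Lambda\mid U\cap\max(D_\lambda)\neq\emptyset\}$; this is an ultrafilter on $\Lambda$. $R^*=\prod^{\mathcal{F}_{\mathcal{U}}}_\lambda D_\lambda$, and $r^*$ is the image of $r\in R$ in $R^*$. $(\mathcal{U})=\{r\in R\mid\{M\in X\mid r_\lambda\in M\}\in\mathcal{U}\}$, a prime ideal of $R$ containing the kernel of $R\to R^*$; $(\mathcal{U})^*$ is its image in $R^*$, and $R^*_{\mathcal{U}}$ is the localization of $R^*$ at $(\mathcal{U})^*$. $K_\lambda$ is the quotient field of $D_\lambda$ and $K^*$ is the quotient field of $R^*$, identified with $\prod_\lambda^{\mathcal{F}_{\mathcal{U}}}K_\lambda$. For $M\in\max(D_\lambda)$, $(D_\lambda)_M$ is the localization of $D_\lambda$ at $M$ (a valuation domain), $v_M$ is the valuation on $K_\lambda$ with valuation ring $(D_\lambda)_M$, and $\Gamma_M$ is its value group. $\Gamma_{\mathcal{U}}$ is a totally ordered abelian group. A valuation is not required to be surjective onto the given group. Valuations are extended by $v(0)=\infty$,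 $v_M(0)=\infty$. *)

theory Defs
  imports "HOL-Algebra.Algebra"
begin

section \<open>Localizations and quotient fields\<close>

definition loc_rel :: "('a, 'm) ring_scheme \<Rightarrow> 'a set \<Rightarrow> (('a \<times> 'a) \<times> ('a \<times> 'a)) set" where
  "loc_rel R S = {((a, s), (b, t)).
     a \<in> carrier R \<and> s \<in> S \<and> b \<in> carrier R \<and> t \<in> S \<and>
     (\<exists>u\<in>S. u \<otimes>\<^bsub>R\<^esub> (a \<otimes>\<^bsub>R\<^esub> t \<ominus>\<^bsub>R\<^esub> b \<otimes>\<^bsub>R\<^esub> s) = \<zero>\<^bsub>R\<^esub>)}"

definition fraction :: "('a, 'm) ring_scheme \<Rightarrow> 'a set \<Rightarrow> 'a \<Rightarrow> 'a \<Rightarrow> ('a \<times> 'a) set" where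
  "fraction R S a s = loc_rel R S `` {(a, s)}"

definition localization :: "('a, 'm) ring_scheme \<Rightarrow> 'a set \<Rightarrow> ('a \<times> 'a) set ring" where
  "localization R S =
    \<lparr> carrier = (carrier R \<times> S) // loc_rel R S,
      monoid.mult = (\<lambda>x y. \<Union>(a, s)\<in>x. \<Union>(b, t)\<in>y. fraction R S (a \<otimes>\<^bsub>R\<^esub> b) (s \<otimes>\<^bsub>R\<^esub> t)),
      one = fraction R S \<one>\<^bsub>R\<^esub> \<one>\<^bsub>R\<^esub>,
      ring.zero = fraction R S \<zero>\<^bsub>R\<^esub> \<one>\<^bsub>R\<^esub>,
      ring.add = (\<lambda>x y. \<Union>(a, s)\<in>x. \<Union>(b, t)\<in>y.
               fraction R S (a \<otimes>\<^bsub>R\<^esub> t \<oplus>\<^bsub>R\<^esub> b \<otimes>\<^bsub>R\<^esub> s) (s \<otimes>\<^bsub>R\<^esub> t)) \<rparr>"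

definition localization_at :: "('a, 'm) ring_scheme \<Rightarrow> 'a set \<Rightarrow> ('a \<times> 'a) set ring" where
  "localization_at R P = localization R (carrier R - P)"

definition quot_field :: "('a, 'm) ring_scheme \<Rightarrow> ('a \<times> 'a) set ring" where
  "quot_field R = localization R (carrier R - {\<zero>\<^bsub>R\<^esub>})"

definition to_quot :: "('a, 'm) ring_scheme \<Rightarrow> 'a \<Rightarrow> ('a \<times> 'a) set" where
  "to_quot R a = fraction R (carrier R - {\<zero>\<^bsub>R\<^esub>}) a \<one>\<^bsub>R\<^esub>"

text \<open>The map \<open>a/s \<mapsto> \<phi>(a) \<phi>(s)\<^sup>-\<^sup>1\<close> from a localization of a ring to \<open>A\<close> that a ring homomorphism
  \<open>\<phi>\<close> into \<open>A\<close> induces. It is meaningful only if \<open>\<phi>\<close> sends all denominators to units of \<open>A\<close>.\<close>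

definition loc_lift :: "('b, 'n) ring_scheme \<Rightarrow> ('a \<Rightarrow> 'b) \<Rightarrow> ('a \<times> 'a) set \<Rightarrow> 'b" where
  "loc_lift A \<phi> x = (THE y. \<exists>(a, s)\<in>x. y = \<phi> a \<otimes>\<^bsub>A\<^esub> inv\<^bsub>A\<^esub> (\<phi> s))"


section \<open>Pruefer domains\<close>

definition max_spec :: "('a, 'm) ring_scheme \<Rightarrow> 'a set set" where
  "max_spec R = {M. maximalideal M R}"

definition inverse_ideal :: "('a, 'm) ring_scheme \<Rightarrow> 'a set \<Rightarrow> ('a \<times> 'a) set set" where
  "inverse_ideal R I =
    {x \<in> carrier (quot_field R). \<forall>a\<in>I. x \<otimes>\<^bsub>quot_field R\<^esub> to_quot R a \<in> to_quot R ` carrier R}"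

text \<open>The library constant \<open>ideal_prod\<close> yields the set of finite sums of products; here it is applied
  to two \<open>R\<close>-submodules of the quotient field.\<close>

definition invertible_ideal :: "('a, 'm) ring_scheme \<Rightarrow> 'a set \<Rightarrow> bool" where
  "invertible_ideal R I \<longleftrightarrow>
    ideal_prod (quot_field R) (to_quot R ` I) (inverse_ideal R I) = to_quot R ` carrier R"

definition pruefer_domain :: "('a, 'm) ring_scheme \<Rightarrow> bool" where
  "pruefer_domain R \<longleftrightarrow> domain R \<and>
    (\<forall>A. finite A \<and> A \<subseteq> carrier R \<and> Idl\<^bsub>R\<^esub> A \<noteq> {\<zero>\<^bsub>R\<^esub>} \<longrightarrow> invertible_ideal R (Idl\<^bsub>R\<^esub> A))"


section \<open>Ordered groups and valuations\<close>

text \<open>Totally ordered abelian groups are written multiplicatively, so \<open>\<one>\<close> is the value of a unit.\<close>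

record 'g ogroup = "'g monoid" +
  ole :: "'g \<Rightarrow> 'g \<Rightarrow> bool"

definition tot_ordered_ab_group :: "('g, 'm) ogroup_scheme \<Rightarrow> bool" where
  "tot_ordered_ab_group G \<longleftrightarrow> comm_group G \<and>
    (\<forall>x\<in>carrier G. ole G x x) \<and>
    (\<forall>x\<in>carrier G. \<forall>y\<in>carrier G. ole G x y \<and> ole G y x \<longrightarrow> x = y) \<and>
    (\<forall>x\<in>carrier G. \<forall>y\<in>carrier G. \<forall>z\<in>carrier G. ole G x y \<and> ole G y z \<longrightarrow> ole G x z) \<and>
    (\<forall>x\<in>carrier G. \<forall>y\<in>carrier G. ole G x y \<or> ole G y x) \<and>
    (\<forall>x\<in>carrier G. \<forall>y\<in>carrier G. \<forall>z\<in>carrier G.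
       ole G x y \<longrightarrow> ole G (x \<otimes>\<^bsub>G\<^esub> z) (y \<otimes>\<^bsub>G\<^esub> z))"

definition omin :: "('g, 'm) ogroup_scheme \<Rightarrow> 'g \<Rightarrow> 'g \<Rightarrow> 'g" where
  "omin G x y = (if ole G x y then x else y)"

text \<open>Valuations are functions on the nonzero elements; the value at zero is irrelevant. They need
  not be surjective.\<close>

definition valuation :: "('k, 'm) ring_scheme \<Rightarrow> ('g, 'n) ogroup_scheme \<Rightarrow> ('k \<Rightarrow> 'g) \<Rightarrow> bool" where
  "valuation K G v \<longleftrightarrow> field K \<and> tot_ordered_ab_group G \<and>
    v \<in> carrier K - {\<zero>\<^bsub>K\<^esub>} \<rightarrow> carrier G \<and>
    (\<forall>x\<in>carrier K - {\<zero>\<^bsub>K\<^esub>}. \<forall>y\<in>carrier K - {\<zero>\<^bsub>K\<^esub>}. v (x \<otimes>\<^bsub>K\<^esub> y) = v x \<otimes>\<^bsub>G\<^esub> v y) \<and>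
    (\<forall>x\<in>carrier K - {\<zero>\<^bsub>K\<^esub>}. \<forall>y\<in>carrier K - {\<zero>\<^bsub>K\<^esub>}.
       x \<oplus>\<^bsub>K\<^esub> y \<noteq> \<zero>\<^bsub>K\<^esub> \<longrightarrow> ole G (omin G (v x) (v y)) (v (x \<oplus>\<^bsub>K\<^esub> y)))"

text \<open>\<open>None\<close> plays the role of \<open>\<infinity>\<close>.\<close>

definition ext_val :: "('k, 'm) ring_scheme \<Rightarrow> ('k \<Rightarrow> 'g) \<Rightarrow> 'k \<Rightarrow> 'g option" where
  "ext_val K v x = (if x = \<zero>\<^bsub>K\<^esub> then None else Some (v x))"

fun ext_le :: "('g, 'm) ogroup_scheme \<Rightarrow> 'g option \<Rightarrow> 'g option \<Rightarrow> bool" where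
  "ext_le G x None = True"
| "ext_le G None (Some y) = False"
| "ext_le G (Some x) (Some y) = ole G x y"

definition valuation_ring ::
  "('k, 'm) ring_scheme \<Rightarrow> ('g, 'n) ogroup_scheme \<Rightarrow> ('k \<Rightarrow> 'g) \<Rightarrow> 'k set" where
  "valuation_ring K G v = {x \<in> carrier K. ext_le G (Some \<one>\<^bsub>G\<^esub>) (ext_val K v x)}"


section \<open>Ultrafilters and ultraproducts\<close>

definition ultrafilter_on :: "'i set \<Rightarrow> 'i set set \<Rightarrow> bool" where
  "ultrafilter_on I U \<longleftrightarrow> U \<subseteq> Pow I \<and> I \<in> U \<and> {} \<notin> U \<and>
    (\<forall>A\<in>U. \<forall>B\<in>U. A \<inter> B \<in> U) \<and>
    (\<forall>A\<in>U. \<forall>B. A \<subseteq> B \<and> B \<subseteq> I \<longrightarrow> B \<in> U) \<and>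
    (\<forall>A. A \<subseteq> I \<longrightarrow> A \<in> U \<or> I - A \<in> U)"

definition ultra_rel :: "'i set \<Rightarrow> 'i set set \<Rightarrow> ('i \<Rightarrow> 'a set) \<Rightarrow> (('i \<Rightarrow> 'a) \<times> ('i \<Rightarrow> 'a)) set" where
  "ultra_rel I U C = {(f, g). f \<in> Pi\<^sub>E I C \<and> g \<in> Pi\<^sub>E I C \<and> {i \<in> I. f i = g i} \<in> U}"

definition ultra_class :: "'i set \<Rightarrow> 'i set set \<Rightarrow> ('i \<Rightarrow> 'a set) \<Rightarrow> ('i \<Rightarrow> 'a) \<Rightarrow> ('i \<Rightarrow> 'a) set" where
  "ultra_class I U C f = ultra_rel I U C `` {f}"

abbreviation (input) carriers :: "('i \<Rightarrow> ('a, 'm) partial_object_scheme) \<Rightarrow> 'i \<Rightarrow> 'a set" where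
  "carriers A \<equiv> \<lambda>i. carrier (A i)"

definition ultraprod_ring ::
  "'i set \<Rightarrow> 'i set set \<Rightarrow> ('i \<Rightarrow> ('a, 'm) ring_scheme) \<Rightarrow> ('i \<Rightarrow> 'a) set ring" where
  "ultraprod_ring I U A =
    \<lparr> carrier = Pi\<^sub>E I (carriers A) // ultra_rel I U (carriers A),
      monoid.mult = (\<lambda>x y. \<Union>f\<in>x. \<Union>g\<in>y. ultra_class I U (carriers A) (\<lambda>i\<in>I. f i \<otimes>\<^bsub>A i\<^esub> g i)),
      one = ultra_class I U (carriers A) (\<lambda>i\<in>I. \<one>\<^bsub>A i\<^esub>),
      ring.zero = ultra_class I U (carriers A) (\<lambda>i\<in>I. \<zero>\<^bsub>A i\<^esub>),
      ring.add = (\<lambda>x y. \<Union>f\<in>x. \<Union>g\<in>y. ultra_class I U (carriers A) (\<lambda>i\<in>I. f i \<oplus>\<^bsub>A i\<^esub> g i)) \<rparr>"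

definition ultraprod_ogroup ::
  "'i set \<Rightarrow> 'i set set \<Rightarrow> ('i \<Rightarrow> ('g, 'm) ogroup_scheme) \<Rightarrow> ('i \<Rightarrow> 'g) set ogroup" where
  "ultraprod_ogroup I U G =
    \<lparr> carrier = Pi\<^sub>E I (carriers G) // ultra_rel I U (carriers G),
      monoid.mult = (\<lambda>x y. \<Union>f\<in>x. \<Union>g\<in>y. ultra_class I U (carriers G) (\<lambda>i\<in>I. f i \<otimes>\<^bsub>G i\<^esub> g i)),
      one = ultra_class I U (carriers G) (\<lambda>i\<in>I. \<one>\<^bsub>G i\<^esub>),
      ole = (\<lambda>x y. \<exists>f\<in>x. \<exists>g\<in>y. {i \<in> I. ole (G i) (f i) (g i)} \<in> U) \<rparr>"


section \<open>Products of domains and ultrafilters on the union of the maximal spectra\<close>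

text \<open>Points of the disjoint union are pairs of an index and a maximal ideal.\<close>

definition max_union :: "'l set \<Rightarrow> ('l \<Rightarrow> ('a, 'm) ring_scheme) \<Rightarrow> ('l \<times> 'a set) set" where
  "max_union \<Lambda> D = (SIGMA l:\<Lambda>. max_spec (D l))"

definition index_filter ::
  "'l set \<Rightarrow> ('l \<Rightarrow> ('a, 'm) ring_scheme) \<Rightarrow> ('l \<times> 'a set) set set \<Rightarrow> 'l set set" where
  "index_filter \<Lambda> D \<U> = (\<lambda>V. {l \<in> \<Lambda>. V \<inter> ({l} \<times> max_spec (D l)) \<noteq> {}}) ` \<U>"

definition R_star ::
  "'l set \<Rightarrow> ('l \<Rightarrow> ('a, 'm) ring_scheme) \<Rightarrow> ('l \<times> 'a set) set set \<Rightarrow> ('l \<Rightarrow> 'a) set ring" where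
  "R_star \<Lambda> D \<U> = ultraprod_ring \<Lambda> (index_filter \<Lambda> D \<U>) D"

definition star ::
  "'l set \<Rightarrow> ('l \<Rightarrow> ('a, 'm) ring_scheme) \<Rightarrow> ('l \<times> 'a set) set set \<Rightarrow> ('l \<Rightarrow> 'a) \<Rightarrow> ('l \<Rightarrow> 'a) set" where
  "star \<Lambda> D \<U> r = ultra_class \<Lambda> (index_filter \<Lambda> D \<U>) (carriers D) r"

definition ultra_ideal ::
  "'l set \<Rightarrow> ('l \<Rightarrow> ('a, 'm) ring_scheme) \<Rightarrow> ('l \<times> 'a set) set set \<Rightarrow> ('l \<Rightarrow> 'a) set" where
  "ultra_ideal \<Lambda> D \<U> =
    {r \<in> Pi\<^sub>E \<Lambda> (carriers D). {(l, M) \<in> max_union \<Lambda> D. r l \<in> M} \<in> \<U>}"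

definition R_star_loc ::
  "'l set \<Rightarrow> ('l \<Rightarrow> ('a, 'm) ring_scheme) \<Rightarrow> ('l \<times> 'a set) set set \<Rightarrow>
     (('l \<Rightarrow> 'a) set \<times> ('l \<Rightarrow> 'a) set) set ring" where
  "R_star_loc \<Lambda> D \<U> = localization_at (R_star \<Lambda> D \<U>) (star \<Lambda> D \<U> ` ultra_ideal \<Lambda> D \<U>)"

definition loc_family ::
  "('l \<Rightarrow> ('a, 'm) ring_scheme) \<Rightarrow> 'l \<times> 'a set \<Rightarrow> ('a \<times> 'a) set ring" where
  "loc_family D = (\<lambda>(l, M). localization_at (D l) M)"

definition loc_ultraprod ::
  "'l set \<Rightarrow> ('l \<Rightarrow> ('a, 'm) ring_scheme) \<Rightarrow> ('l \<times> 'a set) set set \<Rightarrow>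
     ('l \<times> 'a set \<Rightarrow> ('a \<times> 'a) set) set ring" where
  "loc_ultraprod \<Lambda> D \<U> = ultraprod_ring (max_union \<Lambda> D) \<U> (loc_family D)"

definition loc_class ::
  "'l set \<Rightarrow> ('l \<Rightarrow> ('a, 'm) ring_scheme) \<Rightarrow> ('l \<times> 'a set) set set \<Rightarrow> ('l \<Rightarrow> 'a) \<Rightarrow>
     ('l \<times> 'a set \<Rightarrow> ('a \<times> 'a) set) set" where
  "loc_class \<Lambda> D \<U> r = ultra_class (max_union \<Lambda> D) \<U> (carriers (loc_family D))
     (\<lambda>(l, M)\<in>max_union \<Lambda> D. fraction (D l) (carrier (D l) - M) (r l) \<one>\<^bsub>D l\<^esub>)"

text \<open>Maps on an ultraproduct are given on representatives: when the value does not depend on the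
  representative, the union over all representatives is that value.\<close>

definition loc_map ::
  "'l set \<Rightarrow> ('l \<Rightarrow> ('a, 'm) ring_scheme) \<Rightarrow> ('l \<times> 'a set) set set \<Rightarrow> ('l \<Rightarrow> 'a) set \<Rightarrow>
     ('l \<times> 'a set \<Rightarrow> ('a \<times> 'a) set) set" where
  "loc_map \<Lambda> D \<U> x = (\<Union>r\<in>x. loc_class \<Lambda> D \<U> r)"

definition K_star ::
  "'l set \<Rightarrow> ('l \<Rightarrow> ('a, 'm) ring_scheme) \<Rightarrow> ('l \<times> 'a set) set set \<Rightarrow>
     ('l \<Rightarrow> ('a \<times> 'a) set) set ring" where
  "K_star \<Lambda> D \<U> = ultraprod_ring \<Lambda> (index_filter \<Lambda> D \<U>) (\<lambda>l. quot_field (D l))"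

definition K_class ::
  "'l set \<Rightarrow> ('l \<Rightarrow> ('a, 'm) ring_scheme) \<Rightarrow> ('l \<times> 'a set) set set \<Rightarrow>
     ('l \<Rightarrow> ('a \<times> 'a) set) \<Rightarrow> ('l \<Rightarrow> ('a \<times> 'a) set) set" where
  "K_class \<Lambda> D \<U> k = ultra_class \<Lambda> (index_filter \<Lambda> D \<U>) (\<lambda>l. carrier (quot_field (D l))) k"

text \<open>The embedding of \<open>R\<^sup>*\<close> into \<open>K\<^sup>*\<close>, under which \<open>K\<^sup>*\<close> is the quotient field of \<open>R\<^sup>*\<close>.\<close>

definition K_embed ::
  "'l set \<Rightarrow> ('l \<Rightarrow> ('a, 'm) ring_scheme) \<Rightarrow> ('l \<times> 'a set) set set \<Rightarrow> ('l \<Rightarrow> 'a) set \<Rightarrow>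
     ('l \<Rightarrow> ('a \<times> 'a) set) set" where
  "K_embed \<Lambda> D \<U> x = (\<Union>r\<in>x. K_class \<Lambda> D \<U> (\<lambda>l\<in>\<Lambda>. to_quot (D l) (r l)))"

text \<open>Since \<open>v\<^sub>M\<close> and its value group \<open>\<Gamma>\<^sub>M\<close> are determined by the valuation ring only up to an
  isomorphism of ordered groups, every choice of them is admitted. The localization at \<open>M\<close> is compared
  with the valuation ring through its canonical image in the quotient field.\<close>

definition is_value_system ::
  "'l set \<Rightarrow> ('l \<Rightarrow> ('a, 'm) ring_scheme) \<Rightarrow> ('l \<times> 'a set \<Rightarrow> ('g, 'n) ogroup_scheme) \<Rightarrow>
     ('l \<times> 'a set \<Rightarrow> ('a \<times> 'a) set \<Rightarrow> 'g) \<Rightarrow> bool" where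
  "is_value_system \<Lambda> D \<Gamma> v \<longleftrightarrow> (\<forall>(l, M)\<in>max_union \<Lambda> D.
     valuation (quot_field (D l)) (\<Gamma> (l, M)) (v (l, M)) \<and>
     v (l, M) ` (carrier (quot_field (D l)) - {\<zero>\<^bsub>quot_field (D l)\<^esub>}) = carrier (\<Gamma> (l, M)) \<and>
     valuation_ring (quot_field (D l)) (\<Gamma> (l, M)) (v (l, M)) =
       loc_lift (quot_field (D l)) (to_quot (D l)) ` carrier (localization_at (D l) M))"

definition val_class ::
  "'l set \<Rightarrow> ('l \<Rightarrow> ('a, 'm) ring_scheme) \<Rightarrow> ('l \<times> 'a set) set set \<Rightarrow>
     ('l \<times> 'a set \<Rightarrow> ('g, 'n) ogroup_scheme) \<Rightarrow> ('l \<times> 'a set \<Rightarrow> ('a \<times> 'a) set \<Rightarrow> 'g) \<Rightarrow>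
     ('l \<Rightarrow> ('a \<times> 'a) set) \<Rightarrow> ('l \<times> 'a set \<Rightarrow> 'g) set" where
  "val_class \<Lambda> D \<U> \<Gamma> v k = ultra_class (max_union \<Lambda> D) \<U> (carriers \<Gamma>)
     (\<lambda>(l, M)\<in>max_union \<Lambda> D. v (l, M) (k l))"

text \<open>Only representatives without zero components are used, since \<open>v\<^sub>M(0) = \<infinity>\<close> is not in
  \<open>\<Gamma>\<^sub>M\<close>; every nonzero element of \<open>K\<^sup>*\<close> has such a representative.\<close>

definition ultra_val ::
  "'l set \<Rightarrow> ('l \<Rightarrow> ('a, 'm) ring_scheme) \<Rightarrow> ('l \<times> 'a set) set set \<Rightarrow>
     ('l \<times> 'a set \<Rightarrow> ('g, 'n) ogroup_scheme) \<Rightarrow> ('l \<times> 'a set \<Rightarrow> ('a \<times> 'a) set \<Rightarrow> 'g) \<Rightarrow>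
     ('l \<Rightarrow> ('a \<times> 'a) set) set \<Rightarrow> ('l \<times> 'a set \<Rightarrow> 'g) set" where
  "ultra_val \<Lambda> D \<U> \<Gamma> v x =
    (\<Union>k\<in>{k \<in> x. \<forall>l\<in>\<Lambda>. k l \<noteq> \<zero>\<^bsub>quot_field (D l)\<^esub>}. val_class \<Lambda> D \<U> \<Gamma> v k)"

end

theory Submission
  imports Defs
begin

text \<open>The index filter is the image of \<open>\<U>\<close> under the projection of the union onto the indices, so a
  property of \<open>l\<close> holds almost everywhere for the index filter if and only if it holds for
  \<open>\<U>\<close>-almost all points \<open>(l, M)\<close>. All maps of the theorem are therefore computed pointwise on
  representatives, and the comparison of two values of \<open>v\<close> is the pointwise comparison for almost all
  points. The Pruefer property enters only in the inclusion of the valuation ring in the localization: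
  componentwise, \<open>k = p/q = r/s\<close> with \<open>p + s = 1\<close>, and if \<open>k\<close> lies in the localization at \<open>M\<close>, then \<open>M\<close>
  cannot contain both \<open>q\<close> and \<open>s\<close>. Since \<open>\<U>\<close> is an ultrafilter, one of the two denominators avoids
  \<open>M\<close> at almost all points, so a single fraction of \<open>R\<^sup>*\<close> with denominator outside \<open>(\<U>)\<^sup>*\<close>
  represents the given element.\<close>

section \<open>Localizations of domains\<close>

text \<open>An element of the valuation ring has, at almost every point \<open>(l, M)\<close>, some
  fraction \<open>c/u\<close> with \<open>u\<close> outside \<open>M\<close>. But \<open>u\<close>
  depends on \<open>M\<close>, whereas an element of \<open>R\<^sup>*\<close> has only one
  coordinate for all maximal ideals of \<open>D l\<close>; this is the obstacle to writing the
  element as a fraction over \<open>R\<^sup>*\<close>. For \<open>k = a/b\<close> with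
  \<open>b\<close> nonzero, invertibility of the ideal \<open>(a, b)\<close> yields two fractions
  that are chosen from \<open>l\<close> alone and serve all \<open>M\<close> over \<open>l\<close>
  together, so the ultrafilter has to decide only between two alternatives. A representative may
  have zero components, whose value is infinite. Comparisons are therefore settled once, for values
  extended by infinity. Since the valuation ring consists of the elements whose value is at least
  that of 1, its description and assertion (3) are both instances of that one statement.\<close>

lemma (in cring) mult_inv_eq_iff:
  assumes "x \<in> carrier R" "y \<in> carrier R" "u \<in> Units R" "w \<in> Units R"
  shows "x \<otimes> inv u = y \<otimes> inv w \<longleftrightarrow> x \<otimes> w = y \<otimes> u"
proof
  note c [simp] = assms Units_closed[OF assms(3)] Units_closed[OF assms(4)]
    Units_inv_closed[OF assms(3)] Units_inv_closed[OF assms(4)]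
  {
    assume "x \<otimes> inv u = y \<otimes> inv w"
    then have "(x \<otimes> inv u) \<otimes> (u \<otimes> w) = (y \<otimes> inv w) \<otimes> (u \<otimes> w)" by simp
    moreover have "(x \<otimes> inv u) \<otimes> (u \<otimes> w) = x \<otimes> w \<otimes> (u \<otimes> inv u)"
      by (simp add: m_ac del: Units_r_inv Units_l_inv)
    moreover have "(y \<otimes> inv w) \<otimes> (u \<otimes> w) = y \<otimes> u \<otimes> (w \<otimes> inv w)"
      by (simp add: m_ac del: Units_r_inv Units_l_inv)
    ultimately show "x \<otimes> w = y \<otimes> u" by simp
  next
    assume "x \<otimes> w = y \<otimes> u"
    then have "(x \<otimes> w) \<otimes> (inv u \<otimes> inv w) = (y \<otimes> u) \<otimes> (inv u \<otimes> inv w)" by simp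
    moreover have "(x \<otimes> w) \<otimes> (inv u \<otimes> inv w) = x \<otimes> inv u \<otimes> (w \<otimes> inv w)"
      by (simp add: m_ac del: Units_r_inv Units_l_inv)
    moreover have "(y \<otimes> u) \<otimes> (inv u \<otimes> inv w) = y \<otimes> inv w \<otimes> (u \<otimes> inv u)"
      by (simp add: m_ac del: Units_r_inv Units_l_inv)
    ultimately show "x \<otimes> inv u = y \<otimes> inv w" by simp
  }
qed

text \<open>Trades \<open>x = y/u\<close> for \<open>x u = y\<close>, so that inverses need not be
  followed through homomorphisms and ultraproducts.\<close>

lemma (in cring) eq_mult_inv_iff:
  assumes "x \<in> carrier R" "y \<in> carrier R" "u \<in> Units R"
  shows "x = y \<otimes> inv u \<longleftrightarrow> x \<otimes> u = y"
  using mult_inv_eq_iff[of x y \<one> u] assms by simp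

text \<open>Operations on quotients are defined as unions over representatives; this evaluates such
  a union as soon as its members do not depend on the representative.\<close>

lemma UN_const_eq:
  assumes "A \<noteq> {}" and "\<And>x. x \<in> A \<Longrightarrow> f x = c"
  shows "(\<Union>x\<in>A. f x) = c"
  using assms by auto

section \<open>Fractions over a multiplicative subset of a domain\<close>

locale domain_localization = domain R for R (structure) +
  fixes S
  assumes denoms: "submonoid S R" and zero_not_denom: "\<zero> \<notin> S"
begin

lemma denom_closed [simp]: "s \<in> S \<Longrightarrow> s \<in> carrier R"
  using submonoid.subset[OF denoms] by auto

lemma denom_mult [simp]: "s \<in> S \<Longrightarrow> t \<in> S \<Longrightarrow> s \<otimes> t \<in> S"
  by (rule submonoid.m_closed[OF denoms])

lemma denom_one [simp]: "\<one> \<in> S"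
  by (rule submonoid.one_closed[OF denoms])

lemma denom_cancel:
  "\<lbrakk>s \<in> S; a \<in> carrier R; b \<in> carrier R\<rbrakk> \<Longrightarrow> a \<otimes> s = b \<otimes> s \<longleftrightarrow> a = b"
  using m_rcancel[of s a b] zero_not_denom denom_closed[of s] by auto

text \<open>\<open>S\<close> avoids zero and the ring is a domain, so the auxiliary factor
  \<open>u\<close> cancels and equality of fractions is plain cross multiplication.\<close>

lemma loc_rel_eq:
  "loc_rel R S = {((a, s), (b, t)). a \<in> carrier R \<and> s \<in> S \<and> b \<in> carrier R \<and> t \<in> S \<and>
     a \<otimes> t = b \<otimes> s}"
proof -
  have iff: "(\<exists>u\<in>S. u \<otimes> (a \<otimes> t \<ominus> b \<otimes> s) = \<zero>) \<longleftrightarrow> a \<otimes> t = b \<otimes> s"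
    if "a \<in> carrier R" "s \<in> S" "b \<in> carrier R" "t \<in> S" for a s b t
  proof
    assume "\<exists>u\<in>S. u \<otimes> (a \<otimes> t \<ominus> b \<otimes> s) = \<zero>"
    then have "a \<otimes> t \<ominus> b \<otimes> s = \<zero>"
      using integral zero_not_denom that by (metis denom_closed m_closed minus_closed)
    then show "a \<otimes> t = b \<otimes> s"
      using that by simp
  next
    assume "a \<otimes> t = b \<otimes> s"
    then have "\<one> \<otimes> (a \<otimes> t \<ominus> b \<otimes> s) = \<zero>"
      using that by simp
    then show "\<exists>u\<in>S. u \<otimes> (a \<otimes> t \<ominus> b \<otimes> s) = \<zero>"
      using denom_one by blast
  qed
  then show ?thesis
    unfolding loc_rel_def by (intro Collect_cong) (simp add: case_prod_unfold cong: conj_cong)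
qed

lemma equiv_loc_rel: "equiv (carrier R \<times> S) (loc_rel R S)"
proof (rule equivI)
  show "loc_rel R S \<subseteq> (carrier R \<times> S) \<times> (carrier R \<times> S)"
    by (auto simp: loc_rel_eq)
  show "refl_on (carrier R \<times> S) (loc_rel R S)"
    by (auto simp: refl_on_def loc_rel_eq)
  show "sym (loc_rel R S)"
    by (auto simp: sym_def loc_rel_eq)
  show "trans (loc_rel R S)"
  proof (rule transI)
    fix x y z
    assume "(x, y) \<in> loc_rel R S" "(y, z) \<in> loc_rel R S"
    then obtain a s b t c w where xyz: "x = (a, s)" "y = (b, t)" "z = (c, w)"
      and c [simp]: "a \<in> carrier R" "b \<in> carrier R" "c \<in> carrier R" "s \<in> S" "t \<in> S" "w \<in> S"
      and e: "a \<otimes> t = b \<otimes> s" "b \<otimes> w = c \<otimes> t"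
      by (auto simp: loc_rel_eq)
    have "(a \<otimes> w) \<otimes> t = (a \<otimes> t) \<otimes> w" by (simp add: m_ac)
    also have "\<dots> = (b \<otimes> w) \<otimes> s" by (simp add: e(1) m_ac)
    also have "\<dots> = (c \<otimes> s) \<otimes> t" by (simp add: e(2) m_ac)
    finally have "a \<otimes> w = c \<otimes> s" using denom_cancel by simp
    then show "(x, z) \<in> loc_rel R S" by (simp add: xyz loc_rel_eq)
  qed
qed

lemma fraction_eq_iff:
  "\<lbrakk>a \<in> carrier R; b \<in> carrier R; s \<in> S; t \<in> S\<rbrakk> \<Longrightarrow>
    fraction R S a s = fraction R S b t \<longleftrightarrow> a \<otimes> t = b \<otimes> s"
  unfolding fraction_def using eq_equiv_class_iff[OF equiv_loc_rel, of "(a, s)" "(b, t)"]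
  by (simp add: loc_rel_eq)

lemma mem_fraction_iff:
  "\<lbrakk>a \<in> carrier R; s \<in> S\<rbrakk> \<Longrightarrow>
    (b, t) \<in> fraction R S a s \<longleftrightarrow> b \<in> carrier R \<and> t \<in> S \<and> a \<otimes> t = b \<otimes> s"
  by (auto simp: fraction_def loc_rel_eq)

lemma fraction_self: "\<lbrakk>a \<in> carrier R; s \<in> S\<rbrakk> \<Longrightarrow> (a, s) \<in> fraction R S a s"
  by (simp add: mem_fraction_iff)

lemma fraction_closed [simp]:
  "\<lbrakk>a \<in> carrier R; s \<in> S\<rbrakk> \<Longrightarrow> fraction R S a s \<in> carrier (localization R S)"
  unfolding localization_def fraction_def by (auto intro: quotientI)

lemma localizationE:
  assumes "x \<in> carrier (localization R S)"
  obtains a s where "a \<in> carrier R" "s \<in> S" "x = fraction R S a s"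
  using assms unfolding localization_def fraction_def by (auto elim: quotientE)

text \<open>The shared part of the well-definedness of sum and product: \<open>f\<close> is the
  result as a function of numerators and denominators, and it only has to be compared with its value
  at the given fractions.\<close>

lemma fraction_op_UN:
  assumes "a \<in> carrier R" "s \<in> S" "b \<in> carrier R" "t \<in> S"
    and resp: "\<And>a' s' b' t'. \<lbrakk>a' \<in> carrier R; s' \<in> S; b' \<in> carrier R; t' \<in> S;
      a \<otimes> s' = a' \<otimes> s; b \<otimes> t' = b' \<otimes> t\<rbrakk> \<Longrightarrow> f a' s' b' t' = f a s b t"
  shows "(\<Union>(a', s')\<in>fraction R S a s. \<Union>(b', t')\<in>fraction R S b t. f a' s' b' t') = f a s b t"
proof -
  have "(case q of (b', t') \<Rightarrow> f (fst p) (snd p) b' t') = f a s b t"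
    if "p \<in> fraction R S a s" "q \<in> fraction R S b t" for p q
    using that resp[of "fst p" "snd p" "fst q" "snd q"] mem_fraction_iff[OF assms(1,2)]
      mem_fraction_iff[OF assms(3,4)]
    by (cases p; cases q) simp
  then have "(\<Union>(b', t')\<in>fraction R S b t. f (fst p) (snd p) b' t') = f a s b t"
    if "p \<in> fraction R S a s" for p
    using that fraction_self[OF assms(3,4)] by (intro UN_const_eq) auto
  then show ?thesis
    using fraction_self[OF assms(1,2)] by (intro UN_const_eq) (auto simp: case_prod_unfold)
qed

lemma fraction_mult [simp]:
  assumes [simp]: "a \<in> carrier R" "s \<in> S" "b \<in> carrier R" "t \<in> S"
  shows "fraction R S a s \<otimes>\<^bsub>localization R S\<^esub> fraction R S b t = fraction R S (a \<otimes> b) (s \<otimes> t)"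
proof -
  have resp: "fraction R S (a' \<otimes> b') (s' \<otimes> t') = fraction R S (a \<otimes> b) (s \<otimes> t)"
    if [simp]: "a' \<in> carrier R" "s' \<in> S" "b' \<in> carrier R" "t' \<in> S"
      and e: "a \<otimes> s' = a' \<otimes> s" "b \<otimes> t' = b' \<otimes> t" for a' s' b' t'
  proof -
    have "(a' \<otimes> b') \<otimes> (s \<otimes> t) = (a' \<otimes> s) \<otimes> (b' \<otimes> t)" by (simp add: m_ac)
    also have "\<dots> = (a \<otimes> s') \<otimes> (b \<otimes> t')" by (simp only: e)
    also have "\<dots> = (a \<otimes> b) \<otimes> (s' \<otimes> t')" by (simp add: m_ac)
    finally show ?thesis by (simp add: fraction_eq_iff)
  qed
  have "fraction R S a s \<otimes>\<^bsub>localization R S\<^esub> fraction R S b t =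
      (\<Union>(a', s')\<in>fraction R S a s. \<Union>(b', t')\<in>fraction R S b t. fraction R S (a' \<otimes> b') (s' \<otimes> t'))"
    unfolding localization_def by (simp only: monoid.select_convs ring.select_convs)
  also have "\<dots> = fraction R S (a \<otimes> b) (s \<otimes> t)"
    by (rule fraction_op_UN) (fact assms resp)+
  finally show ?thesis .
qed

lemma fraction_add [simp]:
  assumes [simp]: "a \<in> carrier R" "s \<in> S" "b \<in> carrier R" "t \<in> S"
  shows "fraction R S a s \<oplus>\<^bsub>localization R S\<^esub> fraction R S b t =
    fraction R S (a \<otimes> t \<oplus> b \<otimes> s) (s \<otimes> t)"
proof -
  have resp: "fraction R S (a' \<otimes> t' \<oplus> b' \<otimes> s') (s' \<otimes> t') = fraction R S (a \<otimes> t \<oplus> b \<otimes> s) (s \<otimes> t)"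
    if [simp]: "a' \<in> carrier R" "s' \<in> S" "b' \<in> carrier R" "t' \<in> S"
      and e: "a \<otimes> s' = a' \<otimes> s" "b \<otimes> t' = b' \<otimes> t" for a' s' b' t'
  proof -
    have "(a' \<otimes> t' \<oplus> b' \<otimes> s') \<otimes> (s \<otimes> t) =
        (a' \<otimes> s) \<otimes> (t \<otimes> t') \<oplus> (b' \<otimes> t) \<otimes> (s \<otimes> s')" by (simp add: m_ac l_distr r_distr)
    also have "\<dots> = (a \<otimes> s') \<otimes> (t \<otimes> t') \<oplus> (b \<otimes> t') \<otimes> (s \<otimes> s')" by (simp only: e)
    also have "\<dots> = (a \<otimes> t \<oplus> b \<otimes> s) \<otimes> (s' \<otimes> t')" by (simp add: m_ac l_distr r_distr)
    finally show ?thesis by (simp add: fraction_eq_iff)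
  qed
  have "fraction R S a s \<oplus>\<^bsub>localization R S\<^esub> fraction R S b t =
      (\<Union>(a', s')\<in>fraction R S a s. \<Union>(b', t')\<in>fraction R S b t. fraction R S (a' \<otimes> t' \<oplus> b' \<otimes> s') (s' \<otimes> t'))"
    unfolding localization_def by (simp only: monoid.select_convs ring.select_convs)
  also have "\<dots> = fraction R S (a \<otimes> t \<oplus> b \<otimes> s) (s \<otimes> t)"
    by (rule fraction_op_UN) (fact assms resp)+
  finally show ?thesis .
qed

lemma localization_one: "\<one>\<^bsub>localization R S\<^esub> = fraction R S \<one> \<one>"
  and localization_zero: "\<zero>\<^bsub>localization R S\<^esub> = fraction R S \<zero> \<one>"
  by (simp_all add: localization_def)

lemma fraction_eq_zero_iff:
  "\<lbrakk>a \<in> carrier R; s \<in> S\<rbrakk> \<Longrightarrow> fraction R S a s = \<zero>\<^bsub>localization R S\<^esub> \<longleftrightarrow> a = \<zero>"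
  by (simp add: localization_zero fraction_eq_iff)

lemma cring_localization: "cring (localization R S)"
proof (rule cringI)
  show "abelian_group (localization R S)"
  proof (rule abelian_groupI)
    show "\<exists>y\<in>carrier (localization R S). y \<oplus>\<^bsub>localization R S\<^esub> x = \<zero>\<^bsub>localization R S\<^esub>"
      if "x \<in> carrier (localization R S)" for x
      using that
    proof (rule localizationE)
      fix a s assume as: "a \<in> carrier R" "s \<in> S" "x = fraction R S a s"
      then have "fraction R S (\<ominus> a) s \<oplus>\<^bsub>localization R S\<^esub> x = \<zero>\<^bsub>localization R S\<^esub>"
        by (simp add: fraction_eq_zero_iff l_minus l_neg)
      then show ?thesis using as by (meson a_inv_closed fraction_closed)
    qed
  qed (auto elim!: localizationE simp: localization_zero fraction_eq_iff l_distr r_distr m_ac a_ac)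
  show "comm_monoid (localization R S)"
    by (rule comm_monoidI) (auto elim!: localizationE simp: localization_one m_ac)
qed (elim localizationE, simp add: fraction_eq_iff l_distr r_distr m_ac a_ac)

lemma domain_localization: "domain (localization R S)"
proof (intro domain.intro domain_axioms.intro cring_localization)
  show "\<one>\<^bsub>localization R S\<^esub> \<noteq> \<zero>\<^bsub>localization R S\<^esub>"
    by (simp add: localization_one fraction_eq_zero_iff)
  fix x y
  assume xy: "x \<otimes>\<^bsub>localization R S\<^esub> y = \<zero>\<^bsub>localization R S\<^esub>"
    "x \<in> carrier (localization R S)" "y \<in> carrier (localization R S)"
  then obtain a s b t where "a \<in> carrier R" "s \<in> S" "x = fraction R S a s"
    "b \<in> carrier R" "t \<in> S" "y = fraction R S b t"
    by (auto elim!: localizationE)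
  with xy(1) show "x = \<zero>\<^bsub>localization R S\<^esub> \<or> y = \<zero>\<^bsub>localization R S\<^esub>"
    using integral by (simp add: fraction_eq_zero_iff)
qed

lemma fraction_one_hom: "(\<lambda>a. fraction R S a \<one>) \<in> ring_hom R (localization R S)"
  by (rule ring_hom_memI) (simp_all add: localization_one)

lemma fraction_one_eq_iff:
  "\<lbrakk>a \<in> carrier R; b \<in> carrier R\<rbrakk> \<Longrightarrow> fraction R S a \<one> = fraction R S b \<one> \<longleftrightarrow> a = b"
  by (simp add: fraction_eq_iff)

lemma fraction_one_Units: "s \<in> S \<Longrightarrow> fraction R S s \<one> \<in> Units (localization R S)"
proof -
  interpret L: cring "localization R S" by (rule cring_localization)
  assume s: "s \<in> S"
  then have "fraction R S s \<one> \<otimes>\<^bsub>localization R S\<^esub> fraction R S \<one> s = \<one>\<^bsub>localization R S\<^esub>"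
    "fraction R S \<one> s \<otimes>\<^bsub>localization R S\<^esub> fraction R S s \<one> = \<one>\<^bsub>localization R S\<^esub>"
    by (simp_all add: localization_one fraction_eq_iff)
  moreover have "fraction R S s \<one> \<in> carrier (localization R S)"
    "fraction R S \<one> s \<in> carrier (localization R S)"
    using s by simp_all
  ultimately show ?thesis
    unfolding Units_def by blast
qed

end

section \<open>Homomorphisms induced on a localization\<close>

locale localization_lift = domain_localization R S + A: cring A
  for R (structure) and S and A (structure) +
  fixes \<phi>
  assumes hom: "\<phi> \<in> ring_hom R A" and denoms_Units: "\<phi> ` S \<subseteq> Units A"
begin

lemma hom_closed [simp]: "a \<in> carrier R \<Longrightarrow> \<phi> a \<in> carrier A"
  using hom by (rule ring_hom_closed)

lemma denom_Units [simp]: "s \<in> S \<Longrightarrow> \<phi> s \<in> Units A"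
  using denoms_Units by auto

text \<open>The relation \<open>a t = b s\<close> is carried over by \<open>\<phi>\<close> and can
  be divided by the units \<open>\<phi> s\<close> and \<open>\<phi> t\<close>, so all pairs in the
  class give one value and the description by \<open>THE\<close> is legitimate.\<close>

lemma loc_lift_fraction:
  assumes [simp]: "a \<in> carrier R" "s \<in> S"
  shows "loc_lift A \<phi> (fraction R S a s) = \<phi> a \<otimes>\<^bsub>A\<^esub> inv\<^bsub>A\<^esub> \<phi> s"
  unfolding loc_lift_def
proof (rule the_equality)
  show "\<exists>(b, t)\<in>fraction R S a s. \<phi> a \<otimes>\<^bsub>A\<^esub> inv\<^bsub>A\<^esub> \<phi> s = \<phi> b \<otimes>\<^bsub>A\<^esub> inv\<^bsub>A\<^esub> \<phi> t"
    using fraction_self[OF assms] by auto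
  fix y
  assume "\<exists>(b, t)\<in>fraction R S a s. y = \<phi> b \<otimes>\<^bsub>A\<^esub> inv\<^bsub>A\<^esub> \<phi> t"
  then obtain b t where bt [simp]: "b \<in> carrier R" "t \<in> S" "a \<otimes> t = b \<otimes> s"
    and y: "y = \<phi> b \<otimes>\<^bsub>A\<^esub> inv\<^bsub>A\<^esub> \<phi> t"
    by (auto simp: mem_fraction_iff)
  have "\<phi> b \<otimes>\<^bsub>A\<^esub> \<phi> s = \<phi> a \<otimes>\<^bsub>A\<^esub> \<phi> t"
    using bt(3) ring_hom_mult[OF hom] by (metis assms bt(1,2) denom_closed)
  then show "y = \<phi> a \<otimes>\<^bsub>A\<^esub> inv\<^bsub>A\<^esub> \<phi> s"
    by (simp add: y A.mult_inv_eq_iff)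
qed

text \<open>Characterizes the value by an equation without inverses. Such equations can be
  multiplied and added, which is how the homomorphism laws are obtained.\<close>

lemma loc_lift_eq_iff:
  assumes "a \<in> carrier R" "s \<in> S" "y \<in> carrier A"
  shows "y = loc_lift A \<phi> (fraction R S a s) \<longleftrightarrow> y \<otimes>\<^bsub>A\<^esub> \<phi> s = \<phi> a"
  using assms by (simp add: loc_lift_fraction A.eq_mult_inv_iff)

lemma loc_lift_closed:
  "x \<in> carrier (localization R S) \<Longrightarrow> loc_lift A \<phi> x \<in> carrier A"
  by (auto elim!: localizationE simp: loc_lift_fraction)

lemma loc_lift_of: "a \<in> carrier R \<Longrightarrow> loc_lift A \<phi> (fraction R S a \<one>) = \<phi> a"
  by (simp add: loc_lift_fraction ring_hom_one[OF hom])

lemma loc_lift_hom: "loc_lift A \<phi> \<in> ring_hom (localization R S) A"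
proof (rule ring_hom_memI)
  show "loc_lift A \<phi> \<one>\<^bsub>localization R S\<^esub> = \<one>\<^bsub>A\<^esub>"
    by (simp add: localization_one loc_lift_of ring_hom_one[OF hom])
  fix x y
  assume xy: "x \<in> carrier (localization R S)" "y \<in> carrier (localization R S)"
  then obtain a s b t where [simp]: "a \<in> carrier R" "s \<in> S" "b \<in> carrier R" "t \<in> S"
    and x: "x = fraction R S a s" and y: "y = fraction R S b t"
    by (metis localizationE)
  let ?x = "loc_lift A \<phi> x" and ?y = "loc_lift A \<phi> y"
  note [simp] = loc_lift_closed[OF xy(1)] loc_lift_closed[OF xy(2)]
  have "?x \<otimes>\<^bsub>A\<^esub> \<phi> s = \<phi> a" "?y \<otimes>\<^bsub>A\<^esub> \<phi> t = \<phi> b"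
    using loc_lift_eq_iff[of a s ?x] loc_lift_eq_iff[of b t ?y] by (simp_all add: x[symmetric] y[symmetric])
  \<comment> \<open>Read from right to left, the equations eliminate \<open>\<phi> a\<close> and
    \<open>\<phi> b\<close>; what remains are identities in \<open>?x\<close>, \<open>?y\<close>,
    \<open>\<phi> s\<close> and \<open>\<phi> t\<close>.\<close>
  note e = this[symmetric]
  have "?x \<otimes>\<^bsub>A\<^esub> ?y = loc_lift A \<phi> (fraction R S (a \<otimes> b) (s \<otimes> t))"
    by (subst loc_lift_eq_iff) (simp_all add: ring_hom_mult[OF hom] e A.m_ac)
  then show "loc_lift A \<phi> (x \<otimes>\<^bsub>localization R S\<^esub> y) = ?x \<otimes>\<^bsub>A\<^esub> ?y"
    by (simp add: x y)
  have "?x \<oplus>\<^bsub>A\<^esub> ?y = loc_lift A \<phi> (fraction R S (a \<otimes> t \<oplus> b \<otimes> s) (s \<otimes> t))"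
    by (subst loc_lift_eq_iff)
      (simp_all add: ring_hom_mult[OF hom] ring_hom_add[OF hom] e A.m_ac A.l_distr A.r_distr)
  then show "loc_lift A \<phi> (x \<oplus>\<^bsub>localization R S\<^esub> y) = ?x \<oplus>\<^bsub>A\<^esub> ?y"
    by (simp add: x y)
qed (rule loc_lift_closed)

lemma loc_lift_inj:
  assumes "inj_on \<phi> (carrier R)"
  shows "inj_on (loc_lift A \<phi>) (carrier (localization R S))"
proof (rule inj_onI)
  fix x y
  assume xy: "x \<in> carrier (localization R S)" "y \<in> carrier (localization R S)"
    and eq: "loc_lift A \<phi> x = loc_lift A \<phi> y"
  from xy obtain a s b t where [simp]: "a \<in> carrier R" "s \<in> S" "b \<in> carrier R" "t \<in> S"
    and x: "x = fraction R S a s" and y: "y = fraction R S b t"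
    by (metis localizationE)
  from eq have "\<phi> (a \<otimes> t) = \<phi> (b \<otimes> s)"
    by (simp add: x y loc_lift_fraction A.mult_inv_eq_iff ring_hom_mult[OF hom])
  then have "a \<otimes> t = b \<otimes> s"
    using assms by (simp add: inj_on_eq_iff)
  then show "x = y" by (simp add: x y fraction_eq_iff)
qed

text \<open>From \<open>(a/s) (s/1) = a/1\<close> any extension \<open>h\<close> satisfies
  \<open>h(a/s) \<phi>(s) = \<phi>(a)\<close>, and \<open>\<phi>(s)\<close> is a unit.\<close>

lemma loc_lift_unique:
  assumes h: "h \<in> ring_hom (localization R S) A"
    and h_of: "\<And>a. a \<in> carrier R \<Longrightarrow> h (fraction R S a \<one>) = \<phi> a"
    and x: "x \<in> carrier (localization R S)"
  shows "h x = loc_lift A \<phi> x"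
proof -
  from x obtain a s where as [simp]: "a \<in> carrier R" "s \<in> S" and x: "x = fraction R S a s"
    by (rule localizationE)
  have "x \<otimes>\<^bsub>localization R S\<^esub> fraction R S s \<one> = fraction R S a \<one>"
    by (simp add: x fraction_eq_iff m_ac)
  then have "h x \<otimes>\<^bsub>A\<^esub> \<phi> s = \<phi> a"
    using ring_hom_mult[OF h, of x "fraction R S s \<one>"] by (simp add: h_of x)
  then show ?thesis
    using ring_hom_closed[OF h, of x] by (simp add: x loc_lift_eq_iff)
qed

lemma loc_lift_imageI:
  assumes "y \<in> carrier A" "a \<in> carrier R" "s \<in> S" "y \<otimes>\<^bsub>A\<^esub> \<phi> s = \<phi> a"
  shows "y \<in> loc_lift A \<phi> ` carrier (localization R S)"
  using loc_lift_eq_iff[of a s y] assms by (simp add: image_eqI[of _ _ "fraction R S a s"])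

text \<open>Describes the canonical copy of the localization inside \<open>A\<close> by equations in
  \<open>A\<close> alone; in this form it can be compared coordinate by coordinate with a valuation
  ring.\<close>

lemma loc_lift_image:
  "loc_lift A \<phi> ` carrier (localization R S) =
    {y \<in> carrier A. \<exists>a\<in>carrier R. \<exists>s\<in>S. y \<otimes>\<^bsub>A\<^esub> \<phi> s = \<phi> a}"
proof (intro equalityI subsetI)
  fix y assume "y \<in> loc_lift A \<phi> ` carrier (localization R S)"
  then obtain a s where "a \<in> carrier R" "s \<in> S" "y = loc_lift A \<phi> (fraction R S a s)"
    by (auto elim: localizationE)
  then show "y \<in> {y \<in> carrier A. \<exists>a\<in>carrier R. \<exists>s\<in>S. y \<otimes>\<^bsub>A\<^esub> \<phi> s = \<phi> a}"
    using loc_lift_eq_iff[of a s y] loc_lift_closed[of "fraction R S a s"] by auto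
next
  fix y assume "y \<in> {y \<in> carrier A. \<exists>a\<in>carrier R. \<exists>s\<in>S. y \<otimes>\<^bsub>A\<^esub> \<phi> s = \<phi> a}"
  then show "y \<in> loc_lift A \<phi> ` carrier (localization R S)"
    using loc_lift_imageI by blast
qed

end

section \<open>Ultraproducts\<close>

text \<open>The default rule \<open>restrict_PiE\<close> would rewrite \<open>restrict f I \<in> Pi\<^sub>E I C\<close> before the closure lemmas
  below, which are stated for this form, can apply.\<close>

declare restrict_PiE [simp del]

text \<open>Encoded as a library filter so that statements about almost all indices become
  \<open>eventually\<close> and can be combined by \<open>eventually_elim\<close>. The use of
  \<open>Abs_filter\<close> is justified in \<open>eventually_iff\<close>, where the filter laws are
  checked.\<close>

definition ufilter :: "'i set \<Rightarrow> 'i set set \<Rightarrow> 'i filter" where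
  "ufilter I U = Abs_filter (\<lambda>P. {i \<in> I. P i} \<in> U)"

locale ultrafilter =
  fixes I :: "'i set" and U :: "'i set set"
  assumes ultrafilter: "ultrafilter_on I U"
begin

lemma whole: "I \<in> U"
  and empty: "{} \<notin> U"
  using ultrafilter unfolding ultrafilter_on_def by simp_all

lemma inter: "\<lbrakk>A \<in> U; B \<in> U\<rbrakk> \<Longrightarrow> A \<inter> B \<in> U"
  using ultrafilter unfolding ultrafilter_on_def by simp

lemma superset: "\<lbrakk>A \<in> U; A \<subseteq> B; B \<subseteq> I\<rbrakk> \<Longrightarrow> B \<in> U"
  using ultrafilter unfolding ultrafilter_on_def by meson

lemma ultra: "A \<subseteq> I \<Longrightarrow> A \<in> U \<or> I - A \<in> U"
  using ultrafilter unfolding ultrafilter_on_def by simp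

lemma eventually_iff: "eventually P (ufilter I U) \<longleftrightarrow> {i \<in> I. P i} \<in> U"
  unfolding ufilter_def
proof (rule eventually_Abs_filter, unfold_locales)
  show "{i \<in> I. True} \<in> U"
    using whole by simp
next
  fix P Q
  assume "{i \<in> I. P i} \<in> U" "{i \<in> I. Q i} \<in> U"
  from inter[OF this] show "{i \<in> I. P i \<and> Q i} \<in> U"
    by (rule back_subst[of "\<lambda>A. A \<in> U"]) auto
next
  fix P Q
  assume "\<forall>x. P x \<longrightarrow> Q x" "{i \<in> I. P i} \<in> U"
  then show "{i \<in> I. Q i} \<in> U"
    by (rule_tac superset) auto
qed

text \<open>Exactly one of a set and its complement belongs to an ultrafilter, hence negation passes
  through "almost everywhere".\<close>

lemma not_eventually_iff: "\<not> eventually P (ufilter I U) \<longleftrightarrow> (\<forall>\<^sub>F i in ufilter I U. \<not> P i)"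
proof -
  have "I - {i \<in> I. P i} = {i \<in> I. \<not> P i}" "{i \<in> I. P i} \<inter> {i \<in> I. \<not> P i} = {}"
    by auto
  then show ?thesis
    unfolding eventually_iff using ultra[of "{i \<in> I. P i}"] inter empty by fastforce
qed

text \<open>De Morgan, from the rules for negation and conjunction. It is behind the absence of zero
  divisors, the totality of the order, the inequality for sums and the choice between two
  denominators.\<close>

lemma eventually_disj_iff:
  "(\<forall>\<^sub>F i in ufilter I U. P i \<or> Q i) \<longleftrightarrow>
    eventually P (ufilter I U) \<or> eventually Q (ufilter I U)"
  using not_eventually_iff[of P] not_eventually_iff[of Q] not_eventually_iff[of "\<lambda>i. P i \<or> Q i"]
  by (auto simp: eventually_conj_iff)

lemma eventually_index: "\<forall>\<^sub>F i in ufilter I U. i \<in> I"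
  using whole by (simp add: eventually_iff)

lemma eventuallyI: "(\<And>i. i \<in> I \<Longrightarrow> P i) \<Longrightarrow> eventually P (ufilter I U)"
  using eventually_index by (rule eventually_mono)

lemma eventually_cong_index:
  "(\<And>i. i \<in> I \<Longrightarrow> P i \<longleftrightarrow> Q i) \<Longrightarrow> eventually P (ufilter I U) \<longleftrightarrow> eventually Q (ufilter I U)"
  using eventually_index by (rule eventually_subst[OF eventually_mono]) auto

lemma eventually_False_iff [simp]: "\<not> (\<forall>\<^sub>F i in ufilter I U. False)"
  using empty by (simp add: eventually_iff)

lemma equiv_ultra_rel: "equiv (Pi\<^sub>E I C) (ultra_rel I U C)"
proof (rule equivI)
  show "ultra_rel I U C \<subseteq> Pi\<^sub>E I C \<times> Pi\<^sub>E I C"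
    unfolding ultra_rel_def by auto
  show "refl_on (Pi\<^sub>E I C) (ultra_rel I U C)"
    using whole by (auto simp: refl_on_def ultra_rel_def)
  show "sym (ultra_rel I U C)"
    by (auto simp: sym_def ultra_rel_def eq_commute)
  show "trans (ultra_rel I U C)"
  proof (rule transI)
    fix f g h
    assume "(f, g) \<in> ultra_rel I U C" "(g, h) \<in> ultra_rel I U C"
    then have fgh: "f \<in> Pi\<^sub>E I C" "h \<in> Pi\<^sub>E I C"
      and "\<forall>\<^sub>F i in ufilter I U. f i = g i" "\<forall>\<^sub>F i in ufilter I U. g i = h i"
      by (auto simp: ultra_rel_def eventually_iff)
    from this(3,4) have "\<forall>\<^sub>F i in ufilter I U. f i = h i"
      by eventually_elim simp
    with fgh show "(f, h) \<in> ultra_rel I U C"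
      by (simp add: ultra_rel_def eventually_iff)
  qed
qed

lemma ultra_class_eq_iff:
  "\<lbrakk>f \<in> Pi\<^sub>E I C; g \<in> Pi\<^sub>E I C\<rbrakk> \<Longrightarrow>
    ultra_class I U C f = ultra_class I U C g \<longleftrightarrow> (\<forall>\<^sub>F i in ufilter I U. f i = g i)"
  unfolding ultra_class_def using eq_equiv_class_iff[OF equiv_ultra_rel, of f C g]
  by (simp add: ultra_rel_def eventually_iff)

lemma ultra_class_restrict_eq:
  assumes "f \<in> Pi\<^sub>E I C" and "\<And>i. i \<in> I \<Longrightarrow> g i = f i"
  shows "ultra_class I U C (restrict g I) = ultra_class I U C f"
  using assms by (intro arg_cong[where f = "ultra_class I U C"] extensionalityI[of _ I]) (auto simp: PiE_iff)

lemma mem_ultra_class_iff: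
  "f \<in> Pi\<^sub>E I C \<Longrightarrow>
    g \<in> ultra_class I U C f \<longleftrightarrow> g \<in> Pi\<^sub>E I C \<and> (\<forall>\<^sub>F i in ufilter I U. f i = g i)"
  by (simp add: ultra_class_def ultra_rel_def eventually_iff)

lemma ultra_class_self: "f \<in> Pi\<^sub>E I C \<Longrightarrow> f \<in> ultra_class I U C f"
  by (simp add: mem_ultra_class_iff)

lemma ultra_class_UN:
  assumes "f \<in> Pi\<^sub>E I C" and "\<And>g. g \<in> Pi\<^sub>E I C \<Longrightarrow> \<forall>\<^sub>F i in ufilter I U. f i = g i \<Longrightarrow> F g = F f"
  shows "(\<Union>g\<in>ultra_class I U C f. F g) = F f"
proof (rule UN_const_eq)
  show "ultra_class I U C f \<noteq> {}"
    using ultra_class_self[OF assms(1)] by blast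
  show "F g = F f" if "g \<in> ultra_class I U C f" for g
    using that by (intro assms(2)) (simp_all add: mem_ultra_class_iff[OF assms(1)])
qed

text \<open>Changing both arguments almost nowhere changes the coordinatewise result almost nowhere.
  Stated for an arbitrary family \<open>op\<close> of operations, it serves rings and groups
  alike.\<close>

lemma ultra_class_op_UN:
  assumes f: "f \<in> Pi\<^sub>E I C" and g: "g \<in> Pi\<^sub>E I C"
    and closed: "\<And>i x y. \<lbrakk>i \<in> I; x \<in> C i; y \<in> C i\<rbrakk> \<Longrightarrow> op i x y \<in> C i"
  shows "(\<Union>f'\<in>ultra_class I U C f. \<Union>g'\<in>ultra_class I U C g.
      ultra_class I U C (\<lambda>i\<in>I. op i (f' i) (g' i))) = ultra_class I U C (\<lambda>i\<in>I. op i (f i) (g i))"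
proof -
  have resp: "ultra_class I U C (\<lambda>i\<in>I. op i (f' i) (g' i)) = ultra_class I U C (\<lambda>i\<in>I. op i (f i) (g i))"
    if f': "f' \<in> Pi\<^sub>E I C" "\<forall>\<^sub>F i in ufilter I U. f i = f' i"
      and g': "g' \<in> Pi\<^sub>E I C" "\<forall>\<^sub>F i in ufilter I U. g i = g' i" for f' g'
  proof (subst ultra_class_eq_iff)
    show "\<forall>\<^sub>F i in ufilter I U. (\<lambda>i\<in>I. op i (f' i) (g' i)) i = (\<lambda>i\<in>I. op i (f i) (g i)) i"
      using f'(2) g'(2) by eventually_elim simp
  qed (use f g f' g' in \<open>simp_all add: restrict_PiE_iff closed PiE_mem\<close>)
  \<comment> \<open>The two unions are evaluated from the inside: the left representative stays
    fixed while the right one varies.\<close>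
  have "(\<Union>g'\<in>ultra_class I U C g. ultra_class I U C (\<lambda>i\<in>I. op i (f' i) (g' i))) =
      ultra_class I U C (\<lambda>i\<in>I. op i (f' i) (g i))"
    if f': "f' \<in> Pi\<^sub>E I C" "\<forall>\<^sub>F i in ufilter I U. f i = f' i" for f'
  proof (rule ultra_class_UN[OF g])
    fix g' assume "g' \<in> Pi\<^sub>E I C" "\<forall>\<^sub>F i in ufilter I U. g i = g' i"
    from resp[OF f' this] resp[OF f' g]
    show "ultra_class I U C (\<lambda>i\<in>I. op i (f' i) (g' i)) = ultra_class I U C (\<lambda>i\<in>I. op i (f' i) (g i))"
      by simp
  qed
  note inner = this
  show ?thesis
  proof (rule UN_const_eq)
    show "ultra_class I U C f \<noteq> {}"
      using ultra_class_self[OF f] by blast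
    fix f' assume "f' \<in> ultra_class I U C f"
    then have f': "f' \<in> Pi\<^sub>E I C" "\<forall>\<^sub>F i in ufilter I U. f i = f' i"
      by (simp_all add: mem_ultra_class_iff[OF f])
    show "(\<Union>g'\<in>ultra_class I U C g. ultra_class I U C (\<lambda>i\<in>I. op i (f' i) (g' i))) =
        ultra_class I U C (\<lambda>i\<in>I. op i (f i) (g i))"
      using inner[OF f'] resp[OF f' g] by simp
  qed
qed

end

section \<open>Ultraproducts of commutative rings, domains and fields\<close>

locale ultraprod_cring = ultrafilter I U
  for I :: "'i set" and U :: "'i set set" +
  fixes A :: "'i \<Rightarrow> ('a, 'm) ring_scheme"
  assumes crings: "i \<in> I \<Longrightarrow> cring (A i)"
begin

abbreviation cls where
  "cls \<equiv> ultra_class I U (\<lambda>i. carrier (A i))"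

abbreviation P where
  "P \<equiv> ultraprod_ring I U A"

lemma app_closed: "\<lbrakk>f \<in> (\<Pi>\<^sub>E i\<in>I. carrier (A i)); i \<in> I\<rbrakk> \<Longrightarrow> f i \<in> carrier (A i)"
  by (rule PiE_mem)

lemma cls_closed [simp]: "f \<in> (\<Pi>\<^sub>E i\<in>I. carrier (A i)) \<Longrightarrow> cls f \<in> carrier P"
  unfolding ultraprod_ring_def ultra_class_def by (auto intro: quotientI)

lemma carrierE:
  assumes "x \<in> carrier P"
  obtains f where "f \<in> (\<Pi>\<^sub>E i\<in>I. carrier (A i))" "x = cls f"
  using assms unfolding ultraprod_ring_def ultra_class_def by (auto elim: quotientE)

lemma cls_mult:
  assumes "f \<in> (\<Pi>\<^sub>E i\<in>I. carrier (A i))" "g \<in> (\<Pi>\<^sub>E i\<in>I. carrier (A i))"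
  shows "cls f \<otimes>\<^bsub>P\<^esub> cls g = cls (\<lambda>i\<in>I. f i \<otimes>\<^bsub>A i\<^esub> g i)"
  unfolding ultraprod_ring_def monoid.select_convs ring.select_convs
  by (rule ultra_class_op_UN[OF assms]) (simp add: crings cring.cring_simprules)

lemma cls_add:
  assumes "f \<in> (\<Pi>\<^sub>E i\<in>I. carrier (A i))" "g \<in> (\<Pi>\<^sub>E i\<in>I. carrier (A i))"
  shows "cls f \<oplus>\<^bsub>P\<^esub> cls g = cls (\<lambda>i\<in>I. f i \<oplus>\<^bsub>A i\<^esub> g i)"
  unfolding ultraprod_ring_def monoid.select_convs ring.select_convs
  by (rule ultra_class_op_UN[OF assms]) (simp add: crings cring.cring_simprules)

lemma one_eq: "\<one>\<^bsub>P\<^esub> = cls (\<lambda>i\<in>I. \<one>\<^bsub>A i\<^esub>)"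
  and zero_eq: "\<zero>\<^bsub>P\<^esub> = cls (\<lambda>i\<in>I. \<zero>\<^bsub>A i\<^esub>)"
  by (simp_all add: ultraprod_ring_def)

lemma restrict_mult_PiE [simp]:
  "\<lbrakk>f \<in> (\<Pi>\<^sub>E i\<in>I. carrier (A i)); g \<in> (\<Pi>\<^sub>E i\<in>I. carrier (A i))\<rbrakk> \<Longrightarrow>
    (\<lambda>i\<in>I. f i \<otimes>\<^bsub>A i\<^esub> g i) \<in> (\<Pi>\<^sub>E i\<in>I. carrier (A i))"
  by (simp add: restrict_PiE_iff crings cring.cring_simprules app_closed)

lemma restrict_add_PiE [simp]:
  "\<lbrakk>f \<in> (\<Pi>\<^sub>E i\<in>I. carrier (A i)); g \<in> (\<Pi>\<^sub>E i\<in>I. carrier (A i))\<rbrakk> \<Longrightarrow>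
    (\<lambda>i\<in>I. f i \<oplus>\<^bsub>A i\<^esub> g i) \<in> (\<Pi>\<^sub>E i\<in>I. carrier (A i))"
  by (simp add: restrict_PiE_iff crings cring.cring_simprules app_closed)

lemma restrict_one_PiE [simp]: "(\<lambda>i\<in>I. \<one>\<^bsub>A i\<^esub>) \<in> (\<Pi>\<^sub>E i\<in>I. carrier (A i))"
  and restrict_zero_PiE [simp]: "(\<lambda>i\<in>I. \<zero>\<^bsub>A i\<^esub>) \<in> (\<Pi>\<^sub>E i\<in>I. carrier (A i))"
  by (auto intro!: cring.cring_simprules crings)

lemma cls_mult_eq_iff:
  assumes "f \<in> (\<Pi>\<^sub>E i\<in>I. carrier (A i))" "g \<in> (\<Pi>\<^sub>E i\<in>I. carrier (A i))"
    "h \<in> (\<Pi>\<^sub>E i\<in>I. carrier (A i))"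
  shows "cls f \<otimes>\<^bsub>P\<^esub> cls g = cls h \<longleftrightarrow> (\<forall>\<^sub>F i in ufilter I U. f i \<otimes>\<^bsub>A i\<^esub> g i = h i)"
  using assms by (simp add: cls_mult ultra_class_eq_iff cong: eventually_cong_index)

lemma cls_eq_zero_iff:
  "f \<in> (\<Pi>\<^sub>E i\<in>I. carrier (A i)) \<Longrightarrow>
    cls f = \<zero>\<^bsub>P\<^esub> \<longleftrightarrow> (\<forall>\<^sub>F i in ufilter I U. f i = \<zero>\<^bsub>A i\<^esub>)"
  by (simp add: zero_eq ultra_class_eq_iff cong: eventually_cong_index)

lemma cring_ultraprod: "cring P"
proof (rule cringI)
  note simps = cls_mult cls_add one_eq zero_eq crings cring.cring_simprules app_closed
  show "abelian_group P"
  proof (rule abelian_groupI)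
    fix x assume "x \<in> carrier P"
    then obtain f where f: "f \<in> (\<Pi>\<^sub>E i\<in>I. carrier (A i))" "x = cls f"
      by (rule carrierE)
    let ?g = "\<lambda>i\<in>I. \<ominus>\<^bsub>A i\<^esub> f i"
    have g: "?g \<in> (\<Pi>\<^sub>E i\<in>I. carrier (A i))"
      using f by (simp add: restrict_PiE_iff crings cring.cring_simprules app_closed)
    have "cls ?g \<oplus>\<^bsub>P\<^esub> x = \<zero>\<^bsub>P\<^esub>"
      using f g by (simp add: cls_add zero_eq, intro arg_cong[where f = cls] restrict_ext,
        simp add: simps app_closed[OF f(1)])
    with g show "\<exists>y\<in>carrier P. y \<oplus>\<^bsub>P\<^esub> x = \<zero>\<^bsub>P\<^esub>"
      using cls_closed by blast
  next
    fix x assume "x \<in> carrier P"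
    then show "\<zero>\<^bsub>P\<^esub> \<oplus>\<^bsub>P\<^esub> x = x"
      by (elim carrierE) (simp add: cls_add zero_eq, rule ultra_class_restrict_eq, simp_all add: simps)
  next
    fix x y z assume "x \<in> carrier P" "y \<in> carrier P" "z \<in> carrier P"
    then show "x \<oplus>\<^bsub>P\<^esub> y \<oplus>\<^bsub>P\<^esub> z = x \<oplus>\<^bsub>P\<^esub> (y \<oplus>\<^bsub>P\<^esub> z)"
      by (elim carrierE)
        (simp add: cls_add, rule arg_cong[where f = cls], rule restrict_ext, simp add: simps)
  next
    fix x y assume "x \<in> carrier P" "y \<in> carrier P"
    then show "x \<oplus>\<^bsub>P\<^esub> y = y \<oplus>\<^bsub>P\<^esub> x"
      by (elim carrierE)
        (simp add: cls_add, rule arg_cong[where f = cls], rule restrict_ext, simp add: simps)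
  qed (auto elim!: carrierE simp: cls_add zero_eq)
  show "comm_monoid P"
  proof (rule comm_monoidI)
    fix x assume "x \<in> carrier P"
    then show "\<one>\<^bsub>P\<^esub> \<otimes>\<^bsub>P\<^esub> x = x"
      by (elim carrierE) (simp add: cls_mult one_eq, rule ultra_class_restrict_eq,
        simp_all add: app_closed ring.ring_simprules cring.axioms(1) crings)
  next
    fix x y z assume "x \<in> carrier P" "y \<in> carrier P" "z \<in> carrier P"
    then show "x \<otimes>\<^bsub>P\<^esub> y \<otimes>\<^bsub>P\<^esub> z = x \<otimes>\<^bsub>P\<^esub> (y \<otimes>\<^bsub>P\<^esub> z)"
      by (elim carrierE)
        (simp add: cls_mult, rule arg_cong[where f = cls], rule restrict_ext, simp add: simps)
  next
    fix x y assume "x \<in> carrier P" "y \<in> carrier P"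
    then show "x \<otimes>\<^bsub>P\<^esub> y = y \<otimes>\<^bsub>P\<^esub> x"
      by (elim carrierE)
        (simp add: cls_mult, rule arg_cong[where f = cls], rule restrict_ext, simp add: simps)
  qed (auto elim!: carrierE simp: cls_mult one_eq)
  fix x y z assume "x \<in> carrier P" "y \<in> carrier P" "z \<in> carrier P"
  then show "(x \<oplus>\<^bsub>P\<^esub> y) \<otimes>\<^bsub>P\<^esub> z = x \<otimes>\<^bsub>P\<^esub> z \<oplus>\<^bsub>P\<^esub> y \<otimes>\<^bsub>P\<^esub> z"
    by (elim carrierE)
      (simp add: cls_mult cls_add, rule arg_cong[where f = cls], rule restrict_ext, simp add: simps)
qed

text \<open>A product that vanishes almost everywhere has, at almost every index, a vanishing
  factor; the ultrafilter singles out one factor that vanishes almost everywhere.\<close>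

lemma domain_ultraprod:
  assumes "\<And>i. i \<in> I \<Longrightarrow> domain (A i)"
  shows "domain P"
proof (intro domain.intro domain_axioms.intro cring_ultraprod)
  have "\<not> (\<forall>\<^sub>F i in ufilter I U. \<one>\<^bsub>A i\<^esub> = \<zero>\<^bsub>A i\<^esub>)"
    using domain.one_not_zero[OF assms] by (simp add: not_eventually_iff eventuallyI)
  then show "\<one>\<^bsub>P\<^esub> \<noteq> \<zero>\<^bsub>P\<^esub>"
    unfolding one_eq by (simp add: cls_eq_zero_iff cong: eventually_cong_index)
next
  fix x y
  assume xy: "x \<otimes>\<^bsub>P\<^esub> y = \<zero>\<^bsub>P\<^esub>" "x \<in> carrier P" "y \<in> carrier P"
  then obtain f g where fg: "f \<in> (\<Pi>\<^sub>E i\<in>I. carrier (A i))" "g \<in> (\<Pi>\<^sub>E i\<in>I. carrier (A i))"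
    "x = cls f" "y = cls g"
    by (metis carrierE)
  from xy(1) fg have "\<forall>\<^sub>F i in ufilter I U. f i \<otimes>\<^bsub>A i\<^esub> g i = \<zero>\<^bsub>A i\<^esub>"
    by (simp add: cls_mult cls_eq_zero_iff cong: eventually_cong_index)
  then have "\<forall>\<^sub>F i in ufilter I U. f i = \<zero>\<^bsub>A i\<^esub> \<or> g i = \<zero>\<^bsub>A i\<^esub>"
    using eventually_index
  proof eventually_elim
    case (elim i)
    then show ?case using domain.integral[OF assms, of i "f i" "g i"] fg by (auto dest: app_closed)
  qed
  with fg show "x = \<zero>\<^bsub>P\<^esub> \<or> y = \<zero>\<^bsub>P\<^esub>"
    by (simp add: eventually_disj_iff cls_eq_zero_iff)
qed

lemma cls_Units:
  assumes f: "f \<in> (\<Pi>\<^sub>E i\<in>I. carrier (A i))"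
    and unit: "\<forall>\<^sub>F i in ufilter I U. f i \<in> Units (A i)"
  shows "cls f \<in> Units P"
proof -
  \<comment> \<open>Zero is only a filler at the negligible set of indices where \<open>f\<close> is
    not a unit; a representative has to be defined on all of \<open>I\<close>.\<close>
  let ?g = "\<lambda>i\<in>I. if f i \<in> Units (A i) then inv\<^bsub>A i\<^esub> f i else \<zero>\<^bsub>A i\<^esub>"
  have "(if f i \<in> Units (A i) then inv\<^bsub>A i\<^esub> f i else \<zero>\<^bsub>A i\<^esub>) \<in> carrier (A i)" if "i \<in> I" for i
  proof -
    interpret cring "A i" using that by (rule crings)
    show ?thesis by simp
  qed
  then have g: "?g \<in> (\<Pi>\<^sub>E i\<in>I. carrier (A i))"
    by auto
  have "\<forall>\<^sub>F i in ufilter I U. f i \<otimes>\<^bsub>A i\<^esub> ?g i = (\<lambda>i\<in>I. \<one>\<^bsub>A i\<^esub>) i"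
    using unit eventually_index
  proof eventually_elim
    case (elim i)
    interpret cring "A i" using elim by (intro crings)
    show ?case using elim by simp
  qed
  then have "cls f \<otimes>\<^bsub>P\<^esub> cls ?g = \<one>\<^bsub>P\<^esub>"
    using f g by (simp only: one_eq cls_mult_eq_iff restrict_one_PiE)
  moreover have "cls ?g \<otimes>\<^bsub>P\<^esub> cls f = cls f \<otimes>\<^bsub>P\<^esub> cls ?g"
    by (rule comm_monoid.m_comm[OF cring.axioms(2)[OF cring_ultraprod]] cls_closed g f)+
  ultimately show ?thesis
    using cls_closed[OF f] cls_closed[OF g] unfolding Units_def by auto
qed

lemma field_ultraprod:
  assumes "\<And>i. i \<in> I \<Longrightarrow> field (A i)"
  shows "field P"
proof -
  interpret domain P
    by (rule domain_ultraprod) (rule field.axioms(1)[OF assms])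
  show ?thesis
  proof (rule cring_fieldI, intro equalityI subsetI)
    fix x assume x: "x \<in> carrier P - {\<zero>\<^bsub>P\<^esub>}"
    then obtain f where f: "f \<in> (\<Pi>\<^sub>E i\<in>I. carrier (A i))" "x = cls f"
      by (blast elim: carrierE)
    then have "\<forall>\<^sub>F i in ufilter I U. f i \<noteq> \<zero>\<^bsub>A i\<^esub>"
      using x by (simp add: cls_eq_zero_iff not_eventually_iff)
    then have "\<forall>\<^sub>F i in ufilter I U. f i \<in> Units (A i)"
      using eventually_index by eventually_elim (use f in \<open>auto simp: field.field_Units[OF assms] dest: app_closed\<close>)
    with f show "x \<in> Units P" by (simp add: cls_Units)
  next
    fix x assume "x \<in> Units P"
    then show "x \<in> carrier P - {\<zero>\<^bsub>P\<^esub>}"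
      by (auto simp: Units_def)
  qed
qed

end

section \<open>Maps between ultraproducts along a map of index sets\<close>

locale ultra_pullback = I: ultrafilter I U + J: ultrafilter J V
  for I :: "'i set" and U and J :: "'j set" and V +
  fixes p :: "'j \<Rightarrow> 'i"
  assumes p_mem [simp]: "j \<in> J \<Longrightarrow> p j \<in> I"
    and pull: "eventually Q (ufilter I U) \<longleftrightarrow> (\<forall>\<^sub>F j in ufilter J V. Q (p j))"
begin

text \<open>\<open>pull\<close> says that the filter on \<open>I\<close> is the image under
  \<open>p\<close> of the filter on \<open>J\<close>. Representatives equal at almost all
  \<open>i\<close> are thus equal at \<open>p j\<close> for almost all \<open>j\<close>, and the
  induced map does not depend on the choice.\<close>

lemma ultra_map_UN:
  assumes r: "r \<in> Pi\<^sub>E I C" and h: "\<And>j x. \<lbrakk>j \<in> J; x \<in> C (p j)\<rbrakk> \<Longrightarrow> h j x \<in> B j"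
  shows "(\<Union>r'\<in>ultra_class I U C r. ultra_class J V B (\<lambda>j\<in>J. h j (r' (p j)))) =
    ultra_class J V B (\<lambda>j\<in>J. h j (r (p j)))"
proof (rule I.ultra_class_UN[OF r])
  fix r' assume r': "r' \<in> Pi\<^sub>E I C" "\<forall>\<^sub>F i in ufilter I U. r i = r' i"
  from r'(2) have "\<forall>\<^sub>F j in ufilter J V. (\<lambda>j\<in>J. h j (r' (p j))) j = (\<lambda>j\<in>J. h j (r (p j))) j"
    unfolding pull by eventually_elim simp
  then show "ultra_class J V B (\<lambda>j\<in>J. h j (r' (p j))) = ultra_class J V B (\<lambda>j\<in>J. h j (r (p j)))"
    using r r' by (subst J.ultra_class_eq_iff) (simp_all add: restrict_PiE_iff h PiE_mem[where T = C])
qed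

end

text \<open>Covers both canonical maps out of \<open>R\<^sup>*\<close>: into the ultraproduct of the
  localizations, with \<open>p\<close> the projection of a point to its index, and into
  \<open>K\<^sup>*\<close>, with \<open>p\<close> the identity.\<close>

locale ultraprod_map = ultra_pullback I U J V p + A: ultraprod_cring I U A + B: ultraprod_cring J V B
  for I :: "'i set" and U and J :: "'j set" and V and p
    and A :: "'i \<Rightarrow> ('a, 'm) ring_scheme" and B :: "'j \<Rightarrow> ('b, 'n) ring_scheme" +
  fixes h :: "'j \<Rightarrow> 'a \<Rightarrow> 'b" and H
  assumes hom: "j \<in> J \<Longrightarrow> h j \<in> ring_hom (A (p j)) (B j)"
    and H_def: "H = (\<lambda>x. \<Union>r\<in>x. B.cls (\<lambda>j\<in>J. h j (r (p j))))"
begin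

lemma h_closed: "\<lbrakk>j \<in> J; x \<in> carrier (A (p j))\<rbrakk> \<Longrightarrow> h j x \<in> carrier (B j)"
  using hom by (rule ring_hom_closed)

lemma map_PiE: "r \<in> (\<Pi>\<^sub>E i\<in>I. carrier (A i)) \<Longrightarrow>
    (\<lambda>j\<in>J. h j (r (p j))) \<in> (\<Pi>\<^sub>E j\<in>J. carrier (B j))"
  by (simp add: restrict_PiE_iff h_closed A.app_closed)

lemma map_cls:
  "r \<in> (\<Pi>\<^sub>E i\<in>I. carrier (A i)) \<Longrightarrow> H (A.cls r) = B.cls (\<lambda>j\<in>J. h j (r (p j)))"
  unfolding H_def by (rule ultra_map_UN) (auto intro: h_closed)

lemma map_hom: "H \<in> ring_hom A.P B.P"
proof (rule ring_hom_memI)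
  show "H x \<in> carrier B.P" if "x \<in> carrier A.P" for x
    using that by (auto elim!: A.carrierE simp: map_cls map_PiE)
  show "H (x \<otimes>\<^bsub>A.P\<^esub> y) = H x \<otimes>\<^bsub>B.P\<^esub> H y" if "x \<in> carrier A.P" "y \<in> carrier A.P" for x y
    using that
    by (elim A.carrierE)
      (simp add: A.cls_mult B.cls_mult map_cls map_PiE, rule arg_cong[where f = B.cls],
        rule restrict_ext, simp add: ring_hom_mult[OF hom] A.app_closed)
  show "H (x \<oplus>\<^bsub>A.P\<^esub> y) = H x \<oplus>\<^bsub>B.P\<^esub> H y" if "x \<in> carrier A.P" "y \<in> carrier A.P" for x y
    using that
    by (elim A.carrierE)
      (simp add: A.cls_add B.cls_add map_cls map_PiE, rule arg_cong[where f = B.cls],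
        rule restrict_ext, simp add: ring_hom_add[OF hom] A.app_closed)
  show "H \<one>\<^bsub>A.P\<^esub> = \<one>\<^bsub>B.P\<^esub>"
    by (simp add: A.one_eq B.one_eq map_cls, rule arg_cong[where f = B.cls],
        rule restrict_ext, simp add: ring_hom_one[OF hom])
qed

text \<open>Here \<open>pull\<close> is used in the opposite direction: equality at
  \<open>p j\<close> for almost all \<open>j\<close> descends to equality at almost all
  \<open>i\<close>.\<close>

lemma map_inj:
  assumes inj: "\<And>j. j \<in> J \<Longrightarrow> inj_on (h j) (carrier (A (p j)))"
  shows "inj_on H (carrier A.P)"
proof (rule inj_onI, elim A.carrierE)
  fix x y f g
  assume eq: "H x = H y" and f: "f \<in> (\<Pi>\<^sub>E i\<in>I. carrier (A i))" "x = A.cls f"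
    and g: "g \<in> (\<Pi>\<^sub>E i\<in>I. carrier (A i))" "y = A.cls g"
  then have "\<forall>\<^sub>F j in ufilter J V. (\<lambda>j\<in>J. h j (f (p j))) j = (\<lambda>j\<in>J. h j (g (p j))) j"
    using map_PiE by (simp only: map_cls J.ultra_class_eq_iff)
  then have "\<forall>\<^sub>F j in ufilter J V. f (p j) = g (p j)"
    using J.eventually_index
  proof eventually_elim
    case (elim j)
    then show ?case
      using inj_onD[OF inj, of j "f (p j)" "g (p j)"] A.app_closed[OF f(1), of "p j"] A.app_closed[OF g(1), of "p j"]
      by simp
  qed
  then show "x = y"
    using f g by (simp add: I.ultra_class_eq_iff pull)
qed

end

section \<open>Ultraproducts of totally ordered abelian groups\<close>

locale ultraprod_group = ultrafilter I U
  for I :: "'i set" and U :: "'i set set" +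
  fixes G :: "'i \<Rightarrow> ('g, 'm) ogroup_scheme"
  assumes groups: "i \<in> I \<Longrightarrow> tot_ordered_ab_group (G i)"
begin

abbreviation cls where
  "cls \<equiv> ultra_class I U (\<lambda>i. carrier (G i))"

abbreviation P where
  "P \<equiv> ultraprod_ogroup I U G"

lemma comm_groups: "i \<in> I \<Longrightarrow> comm_group (G i)"
  using groups unfolding tot_ordered_ab_group_def by blast

lemma app_closed: "\<lbrakk>f \<in> (\<Pi>\<^sub>E i\<in>I. carrier (G i)); i \<in> I\<rbrakk> \<Longrightarrow> f i \<in> carrier (G i)"
  by (rule PiE_mem)

lemma cls_closed [simp]: "f \<in> (\<Pi>\<^sub>E i\<in>I. carrier (G i)) \<Longrightarrow> cls f \<in> carrier P"
  unfolding ultraprod_ogroup_def ultra_class_def by (auto intro: quotientI)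

lemma carrierE:
  assumes "x \<in> carrier P"
  obtains f where "f \<in> (\<Pi>\<^sub>E i\<in>I. carrier (G i))" "x = cls f"
  using assms unfolding ultraprod_ogroup_def ultra_class_def by (auto elim: quotientE)

lemma group_simps:
  assumes "i \<in> I"
  shows "\<one>\<^bsub>G i\<^esub> \<in> carrier (G i)"
    and "x \<in> carrier (G i) \<Longrightarrow> inv\<^bsub>G i\<^esub> x \<in> carrier (G i)"
    and "x \<in> carrier (G i) \<Longrightarrow> y \<in> carrier (G i) \<Longrightarrow> x \<otimes>\<^bsub>G i\<^esub> y \<in> carrier (G i)"
    and "x \<in> carrier (G i) \<Longrightarrow> y \<in> carrier (G i) \<Longrightarrow> z \<in> carrier (G i) \<Longrightarrow>
      x \<otimes>\<^bsub>G i\<^esub> y \<otimes>\<^bsub>G i\<^esub> z = x \<otimes>\<^bsub>G i\<^esub> (y \<otimes>\<^bsub>G i\<^esub> z)"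
    and "x \<in> carrier (G i) \<Longrightarrow> \<one>\<^bsub>G i\<^esub> \<otimes>\<^bsub>G i\<^esub> x = x"
    and "x \<in> carrier (G i) \<Longrightarrow> inv\<^bsub>G i\<^esub> x \<otimes>\<^bsub>G i\<^esub> x = \<one>\<^bsub>G i\<^esub>"
proof -
  interpret comm_group "G i" using assms by (rule comm_groups)
  show "\<one>\<^bsub>G i\<^esub> \<in> carrier (G i)"
    "x \<in> carrier (G i) \<Longrightarrow> inv\<^bsub>G i\<^esub> x \<in> carrier (G i)"
    "x \<in> carrier (G i) \<Longrightarrow> y \<in> carrier (G i) \<Longrightarrow> x \<otimes>\<^bsub>G i\<^esub> y \<in> carrier (G i)"
    "x \<in> carrier (G i) \<Longrightarrow> y \<in> carrier (G i) \<Longrightarrow> z \<in> carrier (G i) \<Longrightarrow>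
      x \<otimes>\<^bsub>G i\<^esub> y \<otimes>\<^bsub>G i\<^esub> z = x \<otimes>\<^bsub>G i\<^esub> (y \<otimes>\<^bsub>G i\<^esub> z)"
    "x \<in> carrier (G i) \<Longrightarrow> \<one>\<^bsub>G i\<^esub> \<otimes>\<^bsub>G i\<^esub> x = x"
    "x \<in> carrier (G i) \<Longrightarrow> inv\<^bsub>G i\<^esub> x \<otimes>\<^bsub>G i\<^esub> x = \<one>\<^bsub>G i\<^esub>"
    by (simp_all add: m_assoc)
qed

lemma cls_mult:
  assumes "f \<in> (\<Pi>\<^sub>E i\<in>I. carrier (G i))" "g \<in> (\<Pi>\<^sub>E i\<in>I. carrier (G i))"
  shows "cls f \<otimes>\<^bsub>P\<^esub> cls g = cls (\<lambda>i\<in>I. f i \<otimes>\<^bsub>G i\<^esub> g i)"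
  unfolding ultraprod_ogroup_def monoid.select_convs
  by (rule ultra_class_op_UN[OF assms]) (rule group_simps)

lemma one_eq: "\<one>\<^bsub>P\<^esub> = cls (\<lambda>i\<in>I. \<one>\<^bsub>G i\<^esub>)"
  by (simp add: ultraprod_ogroup_def)

text \<open>The order asks only for some comparable pair of representatives; any other pair agrees
  with it almost everywhere and is therefore comparable in the same way.\<close>

lemma cls_ole_iff:
  assumes f: "f \<in> (\<Pi>\<^sub>E i\<in>I. carrier (G i))" and g: "g \<in> (\<Pi>\<^sub>E i\<in>I. carrier (G i))"
  shows "ole P (cls f) (cls g) \<longleftrightarrow> (\<forall>\<^sub>F i in ufilter I U. ole (G i) (f i) (g i))"
proof
  assume "ole P (cls f) (cls g)"
  then obtain f' g' where "f' \<in> cls f" "g' \<in> cls g"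
    and le: "\<forall>\<^sub>F i in ufilter I U. ole (G i) (f' i) (g' i)"
    by (auto simp: ultraprod_ogroup_def eventually_iff)
  then have "\<forall>\<^sub>F i in ufilter I U. f i = f' i" "\<forall>\<^sub>F i in ufilter I U. g i = g' i"
    using f g by (auto simp: mem_ultra_class_iff)
  with le show "\<forall>\<^sub>F i in ufilter I U. ole (G i) (f i) (g i)"
    by eventually_elim simp
next
  assume "\<forall>\<^sub>F i in ufilter I U. ole (G i) (f i) (g i)"
  then show "ole P (cls f) (cls g)"
    using ultra_class_self[OF f] ultra_class_self[OF g]
    by (auto simp: ultraprod_ogroup_def eventually_iff)
qed

lemma restrict_mult_PiE [simp]:
  "\<lbrakk>f \<in> (\<Pi>\<^sub>E i\<in>I. carrier (G i)); g \<in> (\<Pi>\<^sub>E i\<in>I. carrier (G i))\<rbrakk> \<Longrightarrow>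
    (\<lambda>i\<in>I. f i \<otimes>\<^bsub>G i\<^esub> g i) \<in> (\<Pi>\<^sub>E i\<in>I. carrier (G i))"
  by (simp add: restrict_PiE_iff group_simps app_closed)

lemma restrict_one_PiE [simp]: "(\<lambda>i\<in>I. \<one>\<^bsub>G i\<^esub>) \<in> (\<Pi>\<^sub>E i\<in>I. carrier (G i))"
  by (auto intro!: group_simps)

lemma comm_group_ultraprod: "comm_group P"
proof (rule comm_groupI)
  show "\<one>\<^bsub>P\<^esub> \<in> carrier P" by (simp add: one_eq)
  fix x assume x: "x \<in> carrier P"
  then show "\<one>\<^bsub>P\<^esub> \<otimes>\<^bsub>P\<^esub> x = x"
    by (elim carrierE)
      (simp add: cls_mult one_eq, rule ultra_class_restrict_eq,
        simp_all add: group_simps app_closed)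
  from x obtain f where f: "f \<in> (\<Pi>\<^sub>E i\<in>I. carrier (G i))" "x = cls f"
    by (rule carrierE)
  let ?g = "\<lambda>i\<in>I. inv\<^bsub>G i\<^esub> f i"
  have g: "?g \<in> (\<Pi>\<^sub>E i\<in>I. carrier (G i))"
    using f by (simp add: restrict_PiE_iff group_simps app_closed)
  have "cls ?g \<otimes>\<^bsub>P\<^esub> x = \<one>\<^bsub>P\<^esub>"
    using f g by (simp add: cls_mult one_eq)
      (rule arg_cong[where f = cls], rule restrict_ext, simp add: group_simps app_closed)
  with g show "\<exists>y\<in>carrier P. y \<otimes>\<^bsub>P\<^esub> x = \<one>\<^bsub>P\<^esub>"
    using cls_closed by blast
  fix y assume y: "y \<in> carrier P"
  with x show "x \<otimes>\<^bsub>P\<^esub> y \<in> carrier P"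
    by (auto elim!: carrierE simp: cls_mult)
  from x y show "x \<otimes>\<^bsub>P\<^esub> y = y \<otimes>\<^bsub>P\<^esub> x"
    by (elim carrierE)
      (simp add: cls_mult, rule arg_cong[where f = cls], rule restrict_ext,
        simp add: comm_monoid.m_comm[OF comm_group.axioms(1)[OF comm_groups]] app_closed)
  fix z assume z: "z \<in> carrier P"
  from x y z show "x \<otimes>\<^bsub>P\<^esub> y \<otimes>\<^bsub>P\<^esub> z = x \<otimes>\<^bsub>P\<^esub> (y \<otimes>\<^bsub>P\<^esub> z)"
    by (elim carrierE)
      (simp add: cls_mult, rule arg_cong[where f = cls], rule restrict_ext,
        simp add: group_simps app_closed)
qed

lemma
  assumes "i \<in> I" "x \<in> carrier (G i)"
  shows ole_refl: "ole (G i) x x"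
    and ole_antisym: "\<lbrakk>y \<in> carrier (G i); ole (G i) x y; ole (G i) y x\<rbrakk> \<Longrightarrow> x = y"
    and ole_trans: "\<lbrakk>y \<in> carrier (G i); z \<in> carrier (G i); ole (G i) x y; ole (G i) y z\<rbrakk> \<Longrightarrow> ole (G i) x z"
    and ole_total: "y \<in> carrier (G i) \<Longrightarrow> ole (G i) x y \<or> ole (G i) y x"
    and ole_mult: "\<lbrakk>y \<in> carrier (G i); z \<in> carrier (G i); ole (G i) x y\<rbrakk> \<Longrightarrow> ole (G i) (x \<otimes>\<^bsub>G i\<^esub> z) (y \<otimes>\<^bsub>G i\<^esub> z)"
  using groups[OF assms(1)] assms(2) unfolding tot_ordered_ab_group_def by blast+

lemma tot_ordered_ab_group_ultraprod: "tot_ordered_ab_group P"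
  unfolding tot_ordered_ab_group_def
proof (intro conjI ballI impI comm_group_ultraprod)
  fix x assume "x \<in> carrier P"
  then obtain f where f [simp]: "f \<in> (\<Pi>\<^sub>E i\<in>I. carrier (G i))" "x = cls f"
    by (rule carrierE)
  note fm = app_closed[OF f(1)]
  show "ole P x x"
    by (simp add: cls_ole_iff eventuallyI ole_refl fm)
  fix y assume "y \<in> carrier P"
  then obtain g where g [simp]: "g \<in> (\<Pi>\<^sub>E i\<in>I. carrier (G i))" "y = cls g"
    by (rule carrierE)
  note gm = app_closed[OF g(1)]
  show "x = y" if "ole P x y \<and> ole P y x"
  proof -
    from that have "\<forall>\<^sub>F i in ufilter I U. ole (G i) (f i) (g i)"
      "\<forall>\<^sub>F i in ufilter I U. ole (G i) (g i) (f i)"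
      by (simp_all add: cls_ole_iff)
    then have "\<forall>\<^sub>F i in ufilter I U. f i = g i"
      using eventually_index by eventually_elim (simp add: ole_antisym fm gm)
    then show ?thesis by (simp add: ultra_class_eq_iff)
  qed
  \<comment> \<open>At each index one of the two comparisons holds; which one may vary with the
    index, and the ultrafilter decides.\<close>
  show "ole P x y \<or> ole P y x"
    by (simp add: cls_ole_iff eventually_disj_iff[symmetric] eventuallyI ole_total fm gm)
  fix z assume "z \<in> carrier P"
  then obtain h where h [simp]: "h \<in> (\<Pi>\<^sub>E i\<in>I. carrier (G i))" "z = cls h"
    by (rule carrierE)
  note hm = app_closed[OF h(1)]
  show "ole P x z" if "ole P x y \<and> ole P y z"
  proof -
    from that have "\<forall>\<^sub>F i in ufilter I U. ole (G i) (f i) (g i)"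
      "\<forall>\<^sub>F i in ufilter I U. ole (G i) (g i) (h i)"
      by (simp_all add: cls_ole_iff)
    then have "\<forall>\<^sub>F i in ufilter I U. ole (G i) (f i) (h i)"
      using eventually_index
      by eventually_elim (erule (1) ole_trans[rotated 4], simp_all add: fm gm hm)
    then show ?thesis by (simp add: cls_ole_iff)
  qed
  show "ole P (x \<otimes>\<^bsub>P\<^esub> z) (y \<otimes>\<^bsub>P\<^esub> z)" if "ole P x y"
  proof -
    from that have "\<forall>\<^sub>F i in ufilter I U. ole (G i) (f i) (g i)"
      by (simp add: cls_ole_iff)
    then have "\<forall>\<^sub>F i in ufilter I U. ole (G i) ((\<lambda>i\<in>I. f i \<otimes>\<^bsub>G i\<^esub> h i) i) ((\<lambda>i\<in>I. g i \<otimes>\<^bsub>G i\<^esub> h i) i)"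
      using eventually_index by eventually_elim (simp add: ole_mult fm gm hm)
    then show ?thesis by (simp add: cls_ole_iff cls_mult)
  qed
qed

end

section \<open>Maximal ideals and Pruefer domains\<close>

text \<open>Zorn's lemma for the ideals that avoid 1, a property inherited by unions of chains. It
  guarantees that every index has a point of the disjoint union above it.\<close>

lemma (in cring) exists_maximalideal:
  assumes "\<one> \<noteq> \<zero>"
  shows "\<exists>M. maximalideal M R"
proof -
  let ?S = "{J. ideal J R \<and> \<one> \<notin> J}"
  have "\<exists>M\<in>?S. \<forall>J\<in>?S. M \<subseteq> J \<longrightarrow> J = M"
  proof (rule subset_Zorn_nonempty)
    show "?S \<noteq> {}"
      using zeroideal assms by blast
    fix C assume C: "C \<noteq> {}" "subset.chain ?S C"
    then have "subset.chain {J. ideal J R} C"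
      unfolding pred_on.chain_def by blast
    then have "ideal (\<Union>C) R"
      using chain_Union_is_ideal[of C] C(1) by simp
    with C(2) show "\<Union>C \<in> ?S"
      unfolding pred_on.chain_def by auto
  qed
  then obtain M where M: "ideal M R" "\<one> \<notin> M"
    and max: "\<And>J. \<lbrakk>ideal J R; \<one> \<notin> J; M \<subseteq> J\<rbrakk> \<Longrightarrow> J = M"
    by auto
  have "maximalideal M R"
  proof (rule maximalidealI[OF M(1)])
    show "carrier R \<noteq> M"
      using M(2) by auto
    show "J = M \<or> J = carrier R" if "ideal J R" "M \<subseteq> J" for J
      using max[OF that(1) _ that(2)] ideal.one_imp_carrier[OF that(1)] by blast
  qed
  then show ?thesis by blast
qed

section \<open>Quotient fields and fractions over a Pruefer domain\<close>

context "domain"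
begin

lemma domain_localization_nonzero: "domain_localization R (carrier R - {\<zero>})"
proof (intro domain_localization.intro domain_localization_axioms.intro domain_axioms)
  show "submonoid (carrier R - {\<zero>}) R"
    by (rule submonoid.intro) (auto simp: integral_iff)
qed simp

lemma to_quot_hom: "to_quot R \<in> ring_hom R (quot_field R)"
proof -
  interpret domain_localization R "carrier R - {\<zero>}" by (rule domain_localization_nonzero)
  show ?thesis
    using fraction_one_hom unfolding to_quot_def[abs_def] quot_field_def .
qed

lemma to_quot_eq_iff [simp]:
  "\<lbrakk>a \<in> carrier R; b \<in> carrier R\<rbrakk> \<Longrightarrow> to_quot R a = to_quot R b \<longleftrightarrow> a = b"
  unfolding to_quot_def
  by (rule domain_localization.fraction_one_eq_iff[OF domain_localization_nonzero])

lemma to_quot_closed [simp]: "a \<in> carrier R \<Longrightarrow> to_quot R a \<in> carrier (quot_field R)"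
  using to_quot_hom by (rule ring_hom_closed)

lemma to_quot_mult:
  "\<lbrakk>a \<in> carrier R; b \<in> carrier R\<rbrakk> \<Longrightarrow>
    to_quot R a \<otimes>\<^bsub>quot_field R\<^esub> to_quot R b = to_quot R (a \<otimes> b)"
  using ring_hom_mult[OF to_quot_hom] by simp

lemma to_quot_add:
  "\<lbrakk>a \<in> carrier R; b \<in> carrier R\<rbrakk> \<Longrightarrow>
    to_quot R a \<oplus>\<^bsub>quot_field R\<^esub> to_quot R b = to_quot R (a \<oplus> b)"
  using ring_hom_add[OF to_quot_hom] by simp

lemma to_quot_zero: "to_quot R \<zero> = \<zero>\<^bsub>quot_field R\<^esub>"
  by (simp add: to_quot_def quot_field_def localization_def)

lemma to_quot_eq_zero_iff [simp]:
  "a \<in> carrier R \<Longrightarrow> to_quot R a = \<zero>\<^bsub>quot_field R\<^esub> \<longleftrightarrow> a = \<zero>"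
  using to_quot_eq_iff[of a \<zero>] by (simp add: to_quot_zero)

lemma cring_quot_field: "cring (quot_field R)"
  unfolding quot_field_def
  by (rule domain_localization.cring_localization[OF domain_localization_nonzero])

lemma quot_fieldE:
  assumes "k \<in> carrier (quot_field R)"
  obtains a b where "a \<in> carrier R" "b \<in> carrier R" "b \<noteq> \<zero>"
    "k \<otimes>\<^bsub>quot_field R\<^esub> to_quot R b = to_quot R a"
proof -
  interpret domain_localization R "carrier R - {\<zero>}" by (rule domain_localization_nonzero)
  from assms obtain a b where ab: "a \<in> carrier R" "b \<in> carrier R" "b \<noteq> \<zero>"
    and k: "k = fraction R (carrier R - {\<zero>}) a b"
    unfolding quot_field_def by (auto elim!: localizationE)
  then have "k \<otimes>\<^bsub>quot_field R\<^esub> to_quot R b = to_quot R a"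
    unfolding k to_quot_def quot_field_def by (simp add: fraction_eq_iff)
  with ab that show thesis by blast
qed

lemma field_quot_field: "field (quot_field R)"
proof -
  interpret Q: cring "quot_field R" by (rule cring_quot_field)
  interpret Q: domain "quot_field R"
    unfolding quot_field_def
    by (rule domain_localization.domain_localization[OF domain_localization_nonzero])
  show ?thesis
  proof (rule Q.cring_fieldI2)
    fix k assume k: "k \<in> carrier (quot_field R)" "k \<noteq> \<zero>\<^bsub>quot_field R\<^esub>"
    then obtain a b where ab: "a \<in> carrier R" "b \<in> carrier R" "b \<noteq> \<zero>"
      and eq: "k \<otimes>\<^bsub>quot_field R\<^esub> to_quot R b = to_quot R a"
      by (elim quot_fieldE)
    \<comment> \<open>If \<open>a\<close> were zero, then \<open>k b = 0\<close> with both factors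
      nonzero. So \<open>a\<close> becomes invertible, and \<open>b/a\<close> is the inverse of
      \<open>k\<close>.\<close>
    then have "a \<in> carrier R - {\<zero>}"
      using k Q.integral[of k "to_quot R b"] by auto
    then have "to_quot R a \<in> Units (quot_field R)"
      unfolding to_quot_def quot_field_def
      by (rule domain_localization.fraction_one_Units[OF domain_localization_nonzero])
    then have "k \<otimes>\<^bsub>quot_field R\<^esub> (to_quot R b \<otimes>\<^bsub>quot_field R\<^esub> inv\<^bsub>quot_field R\<^esub> to_quot R a)
        = \<one>\<^bsub>quot_field R\<^esub>"
      using k ab by (simp add: Q.m_assoc[symmetric] eq)
    moreover have "to_quot R b \<otimes>\<^bsub>quot_field R\<^esub> inv\<^bsub>quot_field R\<^esub> to_quot R a \<in> carrier (quot_field R)"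
      using ab \<open>to_quot R a \<in> Units (quot_field R)\<close> by simp
    ultimately show "\<exists>k'\<in>carrier (quot_field R). k \<otimes>\<^bsub>quot_field R\<^esub> k' = \<one>\<^bsub>quot_field R\<^esub>"
      by blast
  qed simp
qed

text \<open>If \<open>k = a/b\<close> and \<open>x a + y b = 1\<close> with \<open>x, y\<close> in the inverse of the ideal \<open>(a, b)\<close>, then
  \<open>k = (x a)/(x b) = (y a)/(y b)\<close>, with all four numerators and denominators in the ring.\<close>

lemma pruefer_fractions:
  assumes pruefer: "pruefer_domain R" and k: "k \<in> carrier (quot_field R)"
  obtains p q r s where "p \<in> carrier R" "q \<in> carrier R" "r \<in> carrier R" "s \<in> carrier R"
    "k \<otimes>\<^bsub>quot_field R\<^esub> to_quot R q = to_quot R p"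
    "k \<otimes>\<^bsub>quot_field R\<^esub> to_quot R s = to_quot R r"
    "p \<oplus> s = \<one>"
proof -
  let ?Q = "quot_field R" and ?t = "to_quot R"
  interpret Q: field ?Q by (rule field_quot_field)
  obtain a b where ab [simp]: "a \<in> carrier R" "b \<in> carrier R" and b: "b \<noteq> \<zero>"
    and eq: "k \<otimes>\<^bsub>?Q\<^esub> ?t b = ?t a"
    using k by (rule quot_fieldE)
  define I where "I = Idl {a, b}"
  define J where "J = inverse_ideal R I"
  have "b \<in> I"
    unfolding I_def using genideal_self[of "{a, b}"] by simp
  with b have "I \<noteq> {\<zero>}" by auto
  then have prod: "ideal_prod ?Q (?t ` I) J = ?t ` carrier R"
    using pruefer unfolding pruefer_domain_def invertible_ideal_def I_def J_def by auto
  \<comment> \<open>The generated ideal is an intersection of ideals, so explicit coefficients are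
    obtained by containing it in the sum of the two principal ideals.\<close>
  have I_E: "\<exists>r\<in>carrier R. \<exists>s\<in>carrier R. c = r \<otimes> a \<oplus> s \<otimes> b" if "c \<in> I" for c
  proof -
    have "I \<subseteq> PIdl a <+> PIdl b"
      unfolding I_def
    proof (rule genideal_minimal)
      show "ideal (PIdl a <+> PIdl b) R"
        by (intro add_ideals cgenideal_ideal ab)
      have "a \<otimes> \<one> \<oplus> \<zero> \<otimes> b \<in> PIdl a <+> PIdl b" "\<zero> \<otimes> a \<oplus> \<one> \<otimes> b \<in> PIdl a <+> PIdl b"
        unfolding cgenideal_def set_add_def' by (force simp: m_comm)+
      then show "{a, b} \<subseteq> PIdl a <+> PIdl b" by simp
    qed
    with that show ?thesis
      unfolding cgenideal_def set_add_def' by blast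
  qed
  have J_carrier: "x \<in> carrier ?Q" if "x \<in> J" for x
    using that unfolding J_def inverse_ideal_def by simp
  have J_app: "\<exists>d\<in>carrier R. x \<otimes>\<^bsub>?Q\<^esub> ?t c = ?t d" if "x \<in> J" "c \<in> I" for x c
    using that unfolding J_def inverse_ideal_def by blast
  have I_closed: "c \<in> carrier R" if "c \<in> I" for c
    using I_E[OF that] by auto
  \<comment> \<open>The inverse ideal is an \<open>R\<close>-submodule: scaling absorbs the
    coefficients of an element of \<open>(a, b)\<close>, and addition merges the terms of a
    sum.\<close>
  have J_scale: "x \<otimes>\<^bsub>?Q\<^esub> ?t r \<in> J" if x: "x \<in> J" and r: "r \<in> carrier R" for x r
  proof -
    have "x \<otimes>\<^bsub>?Q\<^esub> ?t r \<otimes>\<^bsub>?Q\<^esub> ?t c \<in> ?t ` carrier R" if c: "c \<in> I" for c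
    proof -
      obtain d where d: "d \<in> carrier R" "x \<otimes>\<^bsub>?Q\<^esub> ?t c = ?t d"
        using J_app[OF x c] by blast
      have "x \<otimes>\<^bsub>?Q\<^esub> ?t r \<otimes>\<^bsub>?Q\<^esub> ?t c = x \<otimes>\<^bsub>?Q\<^esub> ?t c \<otimes>\<^bsub>?Q\<^esub> ?t r"
        using J_carrier[OF x] r I_closed[OF c] by (simp add: Q.m_ac)
      also have "\<dots> = ?t (d \<otimes> r)"
        using d r by (simp add: to_quot_mult)
      finally show ?thesis using d r by auto
    qed
    then show ?thesis
      using J_carrier[OF x] r unfolding J_def inverse_ideal_def by auto
  qed
  have J_add: "x \<oplus>\<^bsub>?Q\<^esub> y \<in> J" if x: "x \<in> J" and y: "y \<in> J" for x y
  proof -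
    have "(x \<oplus>\<^bsub>?Q\<^esub> y) \<otimes>\<^bsub>?Q\<^esub> ?t c \<in> ?t ` carrier R" if c: "c \<in> I" for c
    proof -
      obtain d e where d: "d \<in> carrier R" "x \<otimes>\<^bsub>?Q\<^esub> ?t c = ?t d"
        and e: "e \<in> carrier R" "y \<otimes>\<^bsub>?Q\<^esub> ?t c = ?t e"
        using J_app[OF x c] J_app[OF y c] by blast
      have "(x \<oplus>\<^bsub>?Q\<^esub> y) \<otimes>\<^bsub>?Q\<^esub> ?t c = ?t (d \<oplus> e)"
        using J_carrier[OF x] J_carrier[OF y] I_closed[OF c] d e by (simp add: Q.l_distr to_quot_add)
      then show ?thesis using d e by auto
    qed
    then show ?thesis
      using J_carrier[OF x] J_carrier[OF y] unfolding J_def inverse_ideal_def by auto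
  qed
  \<comment> \<open>Membership in the product gives a sum of arbitrarily many products. Induction
    over its construction collects them into one multiple of \<open>a\<close> and one of
    \<open>b\<close>; applied to 1, this yields the relation \<open>x a + y b = 1\<close>.\<close>
  have "\<exists>x\<in>J. \<exists>y\<in>J. z = x \<otimes>\<^bsub>?Q\<^esub> ?t a \<oplus>\<^bsub>?Q\<^esub> y \<otimes>\<^bsub>?Q\<^esub> ?t b"
    if "z \<in> ideal_prod ?Q (?t ` I) J" for z
    using that
  proof (induction z rule: ideal_prod.induct)
    case (prod i j)
    then obtain c r s where c: "c \<in> I" "i = ?t c" and rs: "r \<in> carrier R" "s \<in> carrier R"
      "c = r \<otimes> a \<oplus> s \<otimes> b"
      using I_E by blast
    have "i \<otimes>\<^bsub>?Q\<^esub> j = (j \<otimes>\<^bsub>?Q\<^esub> ?t r) \<otimes>\<^bsub>?Q\<^esub> ?t a \<oplus>\<^bsub>?Q\<^esub> (j \<otimes>\<^bsub>?Q\<^esub> ?t s) \<otimes>\<^bsub>?Q\<^esub> ?t b"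
      using rs J_carrier[OF prod(2)]
      by (simp add: c to_quot_add[symmetric] to_quot_mult[symmetric] Q.l_distr Q.r_distr Q.m_ac)
    then show ?case using J_scale prod(2) rs by blast
  next
    case (sum z1 z2)
    then obtain x1 y1 x2 y2 where xy: "x1 \<in> J" "y1 \<in> J" "x2 \<in> J" "y2 \<in> J"
      and z: "z1 = x1 \<otimes>\<^bsub>?Q\<^esub> ?t a \<oplus>\<^bsub>?Q\<^esub> y1 \<otimes>\<^bsub>?Q\<^esub> ?t b"
        "z2 = x2 \<otimes>\<^bsub>?Q\<^esub> ?t a \<oplus>\<^bsub>?Q\<^esub> y2 \<otimes>\<^bsub>?Q\<^esub> ?t b"
      by blast
    have "z1 \<oplus>\<^bsub>?Q\<^esub> z2 =
        (x1 \<oplus>\<^bsub>?Q\<^esub> x2) \<otimes>\<^bsub>?Q\<^esub> ?t a \<oplus>\<^bsub>?Q\<^esub> (y1 \<oplus>\<^bsub>?Q\<^esub> y2) \<otimes>\<^bsub>?Q\<^esub> ?t b"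
      using xy[THEN J_carrier] by (simp add: z Q.l_distr Q.a_ac)
    then show ?case using J_add xy by blast
  qed
  moreover have "?t \<one> \<in> ideal_prod ?Q (?t ` I) J"
    using prod by simp
  ultimately obtain x y where x: "x \<in> J" and y: "y \<in> J"
    and one: "?t \<one> = x \<otimes>\<^bsub>?Q\<^esub> ?t a \<oplus>\<^bsub>?Q\<^esub> y \<otimes>\<^bsub>?Q\<^esub> ?t b"
    by blast
  note [simp] = J_carrier[OF x] J_carrier[OF y]
  have "a \<in> I"
    unfolding I_def using genideal_self[of "{a, b}"] by simp
  then obtain p q r s where p: "p \<in> carrier R" "x \<otimes>\<^bsub>?Q\<^esub> ?t a = ?t p"
    and q: "q \<in> carrier R" "x \<otimes>\<^bsub>?Q\<^esub> ?t b = ?t q"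
    and r: "r \<in> carrier R" "y \<otimes>\<^bsub>?Q\<^esub> ?t a = ?t r"
    and s: "s \<in> carrier R" "y \<otimes>\<^bsub>?Q\<^esub> ?t b = ?t s"
    using J_app x y \<open>b \<in> I\<close> by metis
  \<comment> \<open>With \<open>k b = a\<close>, the definition \<open>q = x b\<close> turns
    \<open>k q\<close> into \<open>x a = p\<close>, and likewise \<open>k s\<close> into
    \<open>y a = r\<close>.\<close>
  have "k \<otimes>\<^bsub>?Q\<^esub> ?t q = x \<otimes>\<^bsub>?Q\<^esub> (k \<otimes>\<^bsub>?Q\<^esub> ?t b)" "k \<otimes>\<^bsub>?Q\<^esub> ?t s = y \<otimes>\<^bsub>?Q\<^esub> (k \<otimes>\<^bsub>?Q\<^esub> ?t b)"
    using k by (simp_all add: q(2)[symmetric] s(2)[symmetric] Q.m_ac)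
  moreover have "p \<oplus> s = \<one>"
    using one p s by (simp add: to_quot_add)
  ultimately show thesis
    using that p q r s by (simp add: eq)
qed

text \<open>With \<open>k = c/u\<close> and \<open>k q = p\<close> one has \<open>u p = c q\<close>.
  If \<open>q\<close> and \<open>s\<close> were in \<open>M\<close>, then \<open>c q\<close> would
  be in \<open>M\<close> while neither \<open>u\<close> nor \<open>p = 1 - s\<close> is,
  contradicting primality.\<close>

lemma pruefer_denominator:
  assumes "primeideal M R" and k: "k \<in> carrier (quot_field R)"
    and [simp]: "p \<in> carrier R" "q \<in> carrier R" "s \<in> carrier R"
    and kq: "k \<otimes>\<^bsub>quot_field R\<^esub> to_quot R q = to_quot R p" and ps: "p \<oplus> s = \<one>"
    and cu [simp]: "c \<in> carrier R" "u \<in> carrier R"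
    and u: "u \<notin> M" and ku: "k \<otimes>\<^bsub>quot_field R\<^esub> to_quot R u = to_quot R c"
  shows "q \<notin> M \<or> s \<notin> M"
proof (rule ccontr)
  interpret primeideal M R by fact
  interpret Q: cring "quot_field R" by (rule cring_quot_field)
  assume "\<not> (q \<notin> M \<or> s \<notin> M)"
  then have q: "q \<in> M" and s: "s \<in> M" by auto
  have "p \<notin> M"
  proof
    assume "p \<in> M"
    then have "\<one> \<in> M" using s ps a_closed[of p s] by simp
    then show False using one_imp_carrier I_notcarr by simp
  qed
  have "to_quot R (c \<otimes> q) = k \<otimes>\<^bsub>quot_field R\<^esub> to_quot R u \<otimes>\<^bsub>quot_field R\<^esub> to_quot R q"
    by (simp add: ku to_quot_mult)
  also have "\<dots> = to_quot R u \<otimes>\<^bsub>quot_field R\<^esub> (k \<otimes>\<^bsub>quot_field R\<^esub> to_quot R q)"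
    using k by (simp add: Q.m_ac)
  also have "\<dots> = to_quot R (u \<otimes> p)"
    by (simp add: kq to_quot_mult)
  finally have "u \<otimes> p = c \<otimes> q" by simp
  moreover have "c \<otimes> q \<in> M" using q by (simp add: I_l_closed)
  ultimately show False using I_prime[of u p] u \<open>p \<notin> M\<close> by simp
qed

end

section \<open>Valuations\<close>

text \<open>The value of 1 is idempotent, and a group has only one idempotent.\<close>

lemma valuation_one:
  assumes "valuation K G v"
  shows "v \<one>\<^bsub>K\<^esub> = \<one>\<^bsub>G\<^esub>"
proof -
  interpret K: field K using assms unfolding valuation_def by blast
  interpret G: comm_group G using assms unfolding valuation_def tot_ordered_ab_group_def by blast
  have one: "\<one>\<^bsub>K\<^esub> \<in> carrier K - {\<zero>\<^bsub>K\<^esub>}" by simp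
  then have "v \<one>\<^bsub>K\<^esub> \<in> carrier G"
    using assms unfolding valuation_def by blast
  moreover have "v (\<one>\<^bsub>K\<^esub> \<otimes>\<^bsub>K\<^esub> \<one>\<^bsub>K\<^esub>) = v \<one>\<^bsub>K\<^esub> \<otimes>\<^bsub>G\<^esub> v \<one>\<^bsub>K\<^esub>"
    using assms one unfolding valuation_def by blast
  ultimately show ?thesis
    by (simp add: G.l_cancel_one')
qed

text \<open>Membership becomes a comparison of two values of \<open>v\<close>, so that results on
  comparisons apply to the valuation ring.\<close>

lemma mem_valuation_ring_iff:
  assumes "valuation K G v"
  shows "x \<in> valuation_ring K G v \<longleftrightarrow>
    x \<in> carrier K \<and> ext_le G (ext_val K v \<one>\<^bsub>K\<^esub>) (ext_val K v x)"
proof -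
  interpret K: field K using assms unfolding valuation_def by blast
  show ?thesis
    by (simp add: valuation_ring_def ext_val_def valuation_one[OF assms])
qed

section \<open>The ultraproducts attached to an ultrafilter of maximal ideals\<close>

locale max_ultrafilter = M: ultrafilter "max_union \<Lambda> D" \<U>
  for \<Lambda> :: "'l set" and D :: "'l \<Rightarrow> ('a, 'm) ring_scheme" and \<U> +
  assumes domains: "l \<in> \<Lambda> \<Longrightarrow> domain (D l)"
begin

abbreviation MaxU where "MaxU \<equiv> max_union \<Lambda> D"
abbreviation \<F> where "\<F> \<equiv> index_filter \<Lambda> D \<U>"
abbreviation K where "K \<equiv> \<lambda>l. quot_field (D l)"

lemma fst_index [simp]: "p \<in> MaxU \<Longrightarrow> fst p \<in> \<Lambda>"
  by (auto simp: max_union_def)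

lemma maximalideal: "p \<in> MaxU \<Longrightarrow> maximalideal (snd p) (D (fst p))"
  by (auto simp: max_union_def max_spec_def)

lemma domain_index: "p \<in> MaxU \<Longrightarrow> domain (D (fst p))"
  by (rule domains) simp

lemma primeideal: "p \<in> MaxU \<Longrightarrow> primeideal (snd p) (D (fst p))"
  by (rule cring.maximalideal_prime[OF domain.axioms(1)[OF domain_index] maximalideal])

text \<open>Identifies the given sets with the image filter. A set \<open>V\<close> of the
  ultrafilter lies in the preimage of its own set of indices; conversely, a set of indices is
  recovered from its preimage because no fibre is empty.\<close>

lemma index_filter_eq: "\<F> = {A. A \<subseteq> \<Lambda> \<and> {p \<in> MaxU. fst p \<in> A} \<in> \<U>}"
proof (intro equalityI subsetI)
  fix A assume "A \<in> \<F>"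
  then obtain V where V: "V \<in> \<U>" and A: "A = {l \<in> \<Lambda>. V \<inter> ({l} \<times> max_spec (D l)) \<noteq> {}}"
    unfolding index_filter_def by blast
  have "\<U> \<subseteq> Pow MaxU"
    using M.ultrafilter unfolding ultrafilter_on_def by (rule conjunct1)
  then have "V \<subseteq> MaxU" using V by blast
  then have "V \<subseteq> {p \<in> MaxU. fst p \<in> A}"
    unfolding A max_union_def by fastforce
  then show "A \<in> {A. A \<subseteq> \<Lambda> \<and> {p \<in> MaxU. fst p \<in> A} \<in> \<U>}"
    using M.superset[OF V] unfolding A by auto
next
  fix A assume A: "A \<in> {A. A \<subseteq> \<Lambda> \<and> {p \<in> MaxU. fst p \<in> A} \<in> \<U>}"
  \<comment> \<open>The witness for \<open>A\<close> is the full preimage of \<open>A\<close>; it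
    meets every fibre over \<open>A\<close> since every domain has a maximal ideal.\<close>
  have "{p \<in> MaxU. fst p \<in> A} \<inter> ({l} \<times> max_spec (D l)) \<noteq> {}" if l: "l \<in> A" for l
  proof -
    have "l \<in> \<Lambda>" using A l by blast
    then obtain M where "M \<in> max_spec (D l)"
      using cring.exists_maximalideal[OF domain.axioms(1)[OF domains]] domain.one_not_zero[OF domains]
      by (auto simp: max_spec_def)
    then have "(l, M) \<in> {p \<in> MaxU. fst p \<in> A} \<inter> ({l} \<times> max_spec (D l))"
      using \<open>l \<in> \<Lambda>\<close> l by (simp add: max_union_def)
    then show ?thesis by blast
  qed
  then have "A = {l \<in> \<Lambda>. {p \<in> MaxU. fst p \<in> A} \<inter> ({l} \<times> max_spec (D l)) \<noteq> {}}"
    using A by auto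
  then show "A \<in> \<F>"
    unfolding index_filter_def using A by blast
qed

text \<open>Preimages commute with intersections and complements, so the image filter inherits the
  axioms.\<close>

lemma ultrafilter_index: "ultrafilter_on \<Lambda> \<F>"
proof -
  have pre: "{p \<in> MaxU. fst p \<in> A \<and> fst p \<in> B} = {p \<in> MaxU. fst p \<in> A} \<inter> {p \<in> MaxU. fst p \<in> B}"
    "{p \<in> MaxU. fst p \<in> \<Lambda> \<and> fst p \<notin> A} = MaxU - {p \<in> MaxU. fst p \<in> A}" for A B
    by (auto simp: max_union_def)
  have "{p \<in> MaxU. fst p \<in> \<Lambda>} = MaxU" by (auto simp: max_union_def)
  moreover have "{p \<in> MaxU. fst p \<in> B} \<in> \<U>"
    if "{p \<in> MaxU. fst p \<in> A} \<in> \<U>" "A \<subseteq> B" for A B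
    by (rule M.superset[OF that(1)]) (use that in auto)
  ultimately show ?thesis
    unfolding ultrafilter_on_def index_filter_eq
    using M.whole M.empty M.inter M.ultra[of "{p \<in> MaxU. fst p \<in> _}"] by (auto simp: pre)
qed

sublocale pullback: ultra_pullback \<Lambda> \<F> MaxU \<U> fst
proof (intro ultra_pullback.intro ultra_pullback_axioms.intro M.ultrafilter_axioms)
  show I: "ultrafilter \<Lambda> \<F>"
    by (intro ultrafilter.intro ultrafilter_index)
  have "{p \<in> MaxU. fst p \<in> {l \<in> \<Lambda>. Q l}} = {p \<in> MaxU. Q (fst p)}" for Q
    by (auto simp: max_union_def)
  then show "eventually Q (ufilter \<Lambda> \<F>) \<longleftrightarrow> (\<forall>\<^sub>F p in ufilter MaxU \<U>. Q (fst p))" for Q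
    unfolding ultrafilter.eventually_iff[OF I] M.eventually_iff by (simp add: index_filter_eq)
qed simp

sublocale DD: ultraprod_cring \<Lambda> \<F> D
  by (intro ultraprod_cring.intro ultraprod_cring_axioms.intro pullback.I.ultrafilter_axioms
      domain.axioms(1) domains)

sublocale KK: ultraprod_cring \<Lambda> \<F> K
  by (intro ultraprod_cring.intro ultraprod_cring_axioms.intro pullback.I.ultrafilter_axioms
      domain.cring_quot_field domains)

lemma domain_localization_max:
  assumes "p \<in> MaxU"
  shows "domain_localization (D (fst p)) (carrier (D (fst p)) - snd p)"
proof -
  interpret primeideal "snd p" "D (fst p)" using assms by (rule primeideal)
  interpret domain "D (fst p)" using assms by (rule domain_index)
  show ?thesis
  proof (intro domain_localization.intro domain_localization_axioms.intro domain_axioms)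
    show "submonoid (carrier (D (fst p)) - snd p) (D (fst p))"
      using I_prime one_imp_carrier I_notcarr by (intro submonoid.intro) auto
  qed simp
qed

lemma loc_family_eq:
  "loc_family D p = localization (D (fst p)) (carrier (D (fst p)) - snd p)"
  by (simp add: loc_family_def localization_at_def case_prod_unfold)

sublocale LL: ultraprod_cring MaxU \<U> "loc_family D"
  by (intro ultraprod_cring.intro ultraprod_cring_axioms.intro M.ultrafilter_axioms)
    (simp add: loc_family_eq domain_localization.cring_localization[OF domain_localization_max])

section \<open>The canonical maps from \<open>R\<^sup>*\<close> to the two ultraproducts\<close>

definition to_loc where
  "to_loc p x = fraction (D (fst p)) (carrier (D (fst p)) - snd p) x \<one>\<^bsub>D (fst p)\<^esub>"

lemma loc_class_eq: "loc_class \<Lambda> D \<U> r = LL.cls (\<lambda>p\<in>MaxU. to_loc p (r (fst p)))"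
  by (simp add: loc_class_def to_loc_def case_prod_unfold)

sublocale phi: ultraprod_map \<Lambda> \<F> MaxU \<U> fst D "loc_family D" to_loc "loc_map \<Lambda> D \<U>"
proof unfold_locales
  show "to_loc p \<in> ring_hom (D (fst p)) (loc_family D p)" if "p \<in> MaxU" for p
    unfolding to_loc_def[abs_def] loc_family_eq
    by (rule domain_localization.fraction_one_hom[OF domain_localization_max[OF that]])
  show "loc_map \<Lambda> D \<U> = (\<lambda>x. \<Union>r\<in>x. LL.cls (\<lambda>p\<in>MaxU. to_loc p (r (fst p))))"
    by (simp add: loc_map_def[abs_def] loc_class_eq)
qed

sublocale iota: ultraprod_map \<Lambda> \<F> \<Lambda> \<F> "\<lambda>l. l" D K "\<lambda>l. to_quot (D l)" "K_embed \<Lambda> D \<U>"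
proof unfold_locales
  show "to_quot (D l) \<in> ring_hom (D l) (K l)" if "l \<in> \<Lambda>" for l
    by (rule domain.to_quot_hom[OF domains[OF that]])
  show "K_embed \<Lambda> D \<U> = (\<lambda>x. \<Union>r\<in>x. KK.cls (\<lambda>l\<in>\<Lambda>. to_quot (D l) (r l)))"
    by (simp add: K_embed_def[abs_def] K_class_def)
qed simp_all

lemma phi_inj: "inj_on (loc_map \<Lambda> D \<U>) (carrier DD.P)"
proof (rule phi.map_inj)
  show "inj_on (to_loc p) (carrier (D (fst p)))" if "p \<in> MaxU" for p
    using domain_localization.fraction_one_eq_iff[OF domain_localization_max[OF that]]
    by (simp add: inj_on_def to_loc_def)
qed

lemma iota_inj: "inj_on (K_embed \<Lambda> D \<U>) (carrier DD.P)"
  by (rule iota.map_inj) (simp add: inj_on_def domain.to_quot_eq_iff[OF domains])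

lemma domain_R_star: "domain DD.P"
  by (rule DD.domain_ultraprod[OF domains])

lemma field_K_star: "field KK.P"
  by (rule KK.field_ultraprod) (rule domain.field_quot_field[OF domains])

section \<open>The localization of \<open>R\<^sup>*\<close> at the prime ideal
  \<open>(\<U>)\<^sup>*\<close>\<close>

abbreviation denominators where
  "denominators \<equiv> carrier DD.P - star \<Lambda> D \<U> ` ultra_ideal \<Lambda> D \<U>"

lemma mem_ultra_ideal_iff:
  "r \<in> ultra_ideal \<Lambda> D \<U> \<longleftrightarrow>
    r \<in> (\<Pi>\<^sub>E l\<in>\<Lambda>. carrier (D l)) \<and> (\<forall>\<^sub>F p in ufilter MaxU \<U>. r (fst p) \<in> snd p)"
proof -
  have "{(l, M) \<in> MaxU. r l \<in> M} = {p \<in> MaxU. r (fst p) \<in> snd p}" by auto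
  then show ?thesis by (simp add: ultra_ideal_def M.eventually_iff)
qed

text \<open>Lying in \<open>M\<close> at almost all points is independent of the representative, and
  the ultrafilter turns the failure of this condition into avoidance of \<open>M\<close> at almost
  all points. Denominators can hence be handled pointwise.\<close>

lemma cls_mem_den_iff:
  assumes r: "r \<in> (\<Pi>\<^sub>E l\<in>\<Lambda>. carrier (D l))"
  shows "DD.cls r \<in> denominators \<longleftrightarrow> (\<forall>\<^sub>F p in ufilter MaxU \<U>. r (fst p) \<notin> snd p)"
proof -
  have "DD.cls r \<in> star \<Lambda> D \<U> ` ultra_ideal \<Lambda> D \<U> \<longleftrightarrow>
      (\<forall>\<^sub>F p in ufilter MaxU \<U>. r (fst p) \<in> snd p)"
  proof
    assume "DD.cls r \<in> star \<Lambda> D \<U> ` ultra_ideal \<Lambda> D \<U>"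
    then obtain r' where r': "r' \<in> (\<Pi>\<^sub>E l\<in>\<Lambda>. carrier (D l))" "DD.cls r = DD.cls r'"
      and ev: "\<forall>\<^sub>F p in ufilter MaxU \<U>. r' (fst p) \<in> snd p"
      by (auto simp: star_def mem_ultra_ideal_iff)
    then have "\<forall>\<^sub>F p in ufilter MaxU \<U>. r (fst p) = r' (fst p)"
      using r by (simp add: pullback.I.ultra_class_eq_iff pullback.pull)
    with ev show "\<forall>\<^sub>F p in ufilter MaxU \<U>. r (fst p) \<in> snd p"
      by eventually_elim simp
  next
    assume "\<forall>\<^sub>F p in ufilter MaxU \<U>. r (fst p) \<in> snd p"
    with r show "DD.cls r \<in> star \<Lambda> D \<U> ` ultra_ideal \<Lambda> D \<U>"
      by (auto simp: star_def mem_ultra_ideal_iff)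
  qed
  then show ?thesis
    using r by (simp add: M.not_eventually_iff)
qed

lemma denE:
  assumes "s \<in> denominators"
  obtains r where "r \<in> (\<Pi>\<^sub>E l\<in>\<Lambda>. carrier (D l))" "s = DD.cls r"
    "\<forall>\<^sub>F p in ufilter MaxU \<U>. r (fst p) \<notin> snd p"
proof -
  from assms obtain r where "r \<in> (\<Pi>\<^sub>E l\<in>\<Lambda>. carrier (D l))" "s = DD.cls r"
    by (blast elim: DD.carrierE)
  with that assms cls_mem_den_iff show thesis by blast
qed

text \<open>Closure under products is inherited from the primality of \<open>M\<close> at every
  point: two conditions that hold almost everywhere hold together almost everywhere.\<close>

sublocale den: domain_localization DD.P denominators
proof (intro domain_localization.intro domain_localization_axioms.intro domain_R_star)
  show "submonoid denominators DD.P"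
  proof (rule submonoid.intro)
    have "\<forall>\<^sub>F p in ufilter MaxU \<U>. (\<lambda>l\<in>\<Lambda>. \<one>\<^bsub>D l\<^esub>) (fst p) \<notin> snd p"
    proof (rule M.eventuallyI)
      fix p assume p: "p \<in> MaxU"
      interpret primeideal "snd p" "D (fst p)" using p by (rule primeideal)
      show "(\<lambda>l\<in>\<Lambda>. \<one>\<^bsub>D l\<^esub>) (fst p) \<notin> snd p"
        using one_imp_carrier I_notcarr p by auto
    qed
    then show "\<one>\<^bsub>DD.P\<^esub> \<in> denominators"
      unfolding DD.one_eq by (subst cls_mem_den_iff) simp_all
    fix x y assume "x \<in> denominators" "y \<in> denominators"
    then obtain r s where r: "r \<in> (\<Pi>\<^sub>E l\<in>\<Lambda>. carrier (D l))" "x = DD.cls r"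
        "\<forall>\<^sub>F p in ufilter MaxU \<U>. r (fst p) \<notin> snd p"
      and s: "s \<in> (\<Pi>\<^sub>E l\<in>\<Lambda>. carrier (D l))" "y = DD.cls s"
        "\<forall>\<^sub>F p in ufilter MaxU \<U>. s (fst p) \<notin> snd p"
      by (elim denE)
    from r(3) s(3) M.eventually_index
    have "\<forall>\<^sub>F p in ufilter MaxU \<U>. (\<lambda>l\<in>\<Lambda>. r l \<otimes>\<^bsub>D l\<^esub> s l) (fst p) \<notin> snd p"
    proof eventually_elim
      case (elim p)
      interpret primeideal "snd p" "D (fst p)" using elim(3) by (rule primeideal)
      show ?case
        using elim I_prime DD.app_closed[OF r(1), of "fst p"] DD.app_closed[OF s(1), of "fst p"]
        by auto
    qed
    then show "x \<otimes>\<^bsub>DD.P\<^esub> y \<in> denominators"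
      unfolding r(2) s(2) DD.cls_mult[OF r(1) s(1)] using r(1) s(1) by (subst cls_mem_den_iff) simp_all
  qed simp
  have "\<forall>\<^sub>F p in ufilter MaxU \<U>. (\<lambda>l\<in>\<Lambda>. \<zero>\<^bsub>D l\<^esub>) (fst p) \<in> snd p"
  proof (rule M.eventuallyI)
    fix p assume p: "p \<in> MaxU"
    interpret primeideal "snd p" "D (fst p)" using p by (rule primeideal)
    show "(\<lambda>l\<in>\<Lambda>. \<zero>\<^bsub>D l\<^esub>) (fst p) \<in> snd p" using p by simp
  qed
  then have "\<not> (\<forall>\<^sub>F p in ufilter MaxU \<U>. (\<lambda>l\<in>\<Lambda>. \<zero>\<^bsub>D l\<^esub>) (fst p) \<notin> snd p)"
    by (subst M.not_eventually_iff) simp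
  then show "\<zero>\<^bsub>DD.P\<^esub> \<notin> denominators"
    unfolding DD.zero_eq by (subst cls_mem_den_iff) simp_all
qed

text \<open>A denominator avoids \<open>M\<close> at almost all points, so it becomes a unit in
  almost all of the local rings, and inverses can be taken coordinatewise.\<close>

sublocale psi: localization_lift DD.P denominators LL.P "loc_map \<Lambda> D \<U>"
proof (intro localization_lift.intro localization_lift_axioms.intro den.domain_localization_axioms
    LL.cring_ultraprod phi.map_hom)
  show "loc_map \<Lambda> D \<U> ` denominators \<subseteq> Units LL.P"
  proof
    fix y assume "y \<in> loc_map \<Lambda> D \<U> ` denominators"
    then obtain s where s: "s \<in> denominators" and y: "y = loc_map \<Lambda> D \<U> s"
      by blast
    from s obtain r where r: "r \<in> (\<Pi>\<^sub>E l\<in>\<Lambda>. carrier (D l))" and s: "s = DD.cls r"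
      and ev: "\<forall>\<^sub>F p in ufilter MaxU \<U>. r (fst p) \<notin> snd p"
      by (rule denE)
    from ev M.eventually_index
    have "\<forall>\<^sub>F p in ufilter MaxU \<U>. (\<lambda>p\<in>MaxU. to_loc p (r (fst p))) p \<in> Units (loc_family D p)"
    proof eventually_elim
      case (elim p)
      then show ?case
        using domain_localization.fraction_one_Units[OF domain_localization_max, of p "r (fst p)"]
          DD.app_closed[OF r, of "fst p"] by (simp add: to_loc_def loc_family_eq)
    qed
    then show "y \<in> Units LL.P"
      unfolding y s phi.map_cls[OF r] by (intro LL.cls_Units phi.map_PiE r)
  qed
qed

section \<open>\<open>K\<^sup>*\<close> as the quotient field of \<open>R\<^sup>*\<close>\<close>

lemma domain_localization_R_star: "domain_localization DD.P (carrier DD.P - {\<zero>\<^bsub>DD.P\<^esub>})"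
  by (rule domain.domain_localization_nonzero[OF domain_R_star])

lemma iota_nonzero_Units: "K_embed \<Lambda> D \<U> ` (carrier DD.P - {\<zero>\<^bsub>DD.P\<^esub>}) \<subseteq> Units KK.P"
proof
  interpret hom: ring_hom_cring DD.P KK.P "K_embed \<Lambda> D \<U>"
    by (intro ring_hom_cring.intro ring_hom_cring_axioms.intro DD.cring_ultraprod KK.cring_ultraprod
        iota.map_hom)
  fix y assume "y \<in> K_embed \<Lambda> D \<U> ` (carrier DD.P - {\<zero>\<^bsub>DD.P\<^esub>})"
  then obtain x where x: "x \<in> carrier DD.P" "x \<noteq> \<zero>\<^bsub>DD.P\<^esub>" "y = K_embed \<Lambda> D \<U> x"
    by blast
  then have "y \<noteq> \<zero>\<^bsub>KK.P\<^esub>"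
    using inj_onD[OF iota_inj, of x "\<zero>\<^bsub>DD.P\<^esub>"] by auto
  then show "y \<in> Units KK.P"
    using x by (simp add: field.field_Units[OF field_K_star])
qed

sublocale quot: localization_lift DD.P "carrier DD.P - {\<zero>\<^bsub>DD.P\<^esub>}" KK.P "K_embed \<Lambda> D \<U>"
  by (intro localization_lift.intro localization_lift_axioms.intro domain_localization_R_star
      KK.cring_ultraprod iota.map_hom iota_nonzero_Units)

text \<open>The same denominators as for \<open>psi\<close>, now with target
  \<open>K\<^sup>*\<close>: this realizes the localization inside the field on which the valuation
  lives.\<close>

sublocale loc: localization_lift DD.P denominators KK.P "K_embed \<Lambda> D \<U>"
proof (intro localization_lift.intro localization_lift_axioms.intro den.domain_localization_axioms
    KK.cring_ultraprod iota.map_hom)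
  have "denominators \<subseteq> carrier DD.P - {\<zero>\<^bsub>DD.P\<^esub>}"
    using den.zero_not_denom by blast
  then show "K_embed \<Lambda> D \<U> ` denominators \<subseteq> Units KK.P"
    using iota_nonzero_Units by blast
qed

lemma iota_mult_eq_iff:
  assumes k: "k \<in> (\<Pi>\<^sub>E l\<in>\<Lambda>. carrier (K l))" and a: "a \<in> (\<Pi>\<^sub>E l\<in>\<Lambda>. carrier (D l))"
    and b: "b \<in> (\<Pi>\<^sub>E l\<in>\<Lambda>. carrier (D l))"
  shows "KK.cls k \<otimes>\<^bsub>KK.P\<^esub> K_embed \<Lambda> D \<U> (DD.cls b) = K_embed \<Lambda> D \<U> (DD.cls a) \<longleftrightarrow>
    (\<forall>\<^sub>F l in ufilter \<Lambda> \<F>. k l \<otimes>\<^bsub>K l\<^esub> to_quot (D l) (b l) = to_quot (D l) (a l))"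
  unfolding iota.map_cls[OF a] iota.map_cls[OF b]
    KK.cls_mult_eq_iff[OF k iota.map_PiE[OF b] iota.map_PiE[OF a]]
  by (rule pullback.I.eventually_cong_index) simp

text \<open>Numerators and denominators are chosen index by index; a family of denominators that are
  all nonzero has a nonzero class.\<close>

lemma quot_surj: "loc_lift KK.P (K_embed \<Lambda> D \<U>) ` carrier (quot_field DD.P) = carrier KK.P"
proof (intro equalityI subsetI)
  fix x assume "x \<in> loc_lift KK.P (K_embed \<Lambda> D \<U>) ` carrier (quot_field DD.P)"
  then show "x \<in> carrier KK.P"
    unfolding quot_field_def[of DD.P] quot.loc_lift_image by blast
next
  fix x assume "x \<in> carrier KK.P"
  then obtain k where k: "k \<in> (\<Pi>\<^sub>E l\<in>\<Lambda>. carrier (K l))" "x = KK.cls k"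
    by (rule KK.carrierE)
  have "\<exists>a b. a \<in> carrier (D l) \<and> b \<in> carrier (D l) \<and> b \<noteq> \<zero>\<^bsub>D l\<^esub> \<and>
      k l \<otimes>\<^bsub>K l\<^esub> to_quot (D l) b = to_quot (D l) a" if "l \<in> \<Lambda>" for l
    by (rule domain.quot_fieldE[OF domains[OF that] KK.app_closed[OF k(1) that]]) blast
  then obtain a b where ab: "\<And>l. l \<in> \<Lambda> \<Longrightarrow> a l \<in> carrier (D l) \<and> b l \<in> carrier (D l) \<and>
      b l \<noteq> \<zero>\<^bsub>D l\<^esub> \<and> k l \<otimes>\<^bsub>K l\<^esub> to_quot (D l) (b l) = to_quot (D l) (a l)"
    by metis
  have PiE: "restrict a \<Lambda> \<in> (\<Pi>\<^sub>E l\<in>\<Lambda>. carrier (D l))" "restrict b \<Lambda> \<in> (\<Pi>\<^sub>E l\<in>\<Lambda>. carrier (D l))"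
    using ab by (simp_all add: restrict_PiE_iff)
  have "\<not> (\<forall>\<^sub>F l in ufilter \<Lambda> \<F>. restrict b \<Lambda> l = \<zero>\<^bsub>D l\<^esub>)"
    unfolding pullback.I.not_eventually_iff by (rule pullback.I.eventuallyI) (simp add: ab)
  then have b_mem: "DD.cls (restrict b \<Lambda>) \<in> carrier DD.P - {\<zero>\<^bsub>DD.P\<^esub>}"
    using DD.cls_eq_zero_iff[OF PiE(2)] DD.cls_closed[OF PiE(2)] by blast
  have eq: "x \<otimes>\<^bsub>KK.P\<^esub> K_embed \<Lambda> D \<U> (DD.cls (restrict b \<Lambda>)) =
      K_embed \<Lambda> D \<U> (DD.cls (restrict a \<Lambda>))"
    unfolding k(2) iota_mult_eq_iff[OF k(1) PiE] by (rule pullback.I.eventuallyI) (simp add: ab)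
  show "x \<in> loc_lift KK.P (K_embed \<Lambda> D \<U>) ` carrier (quot_field DD.P)"
    unfolding quot_field_def[of DD.P]
    by (rule quot.loc_lift_imageI[OF \<open>x \<in> carrier KK.P\<close> DD.cls_closed[OF PiE(1)] b_mem eq])
qed

lemma quot_iso: "loc_lift KK.P (K_embed \<Lambda> D \<U>) \<in> ring_iso (quot_field DD.P) KK.P"
  using quot.loc_lift_hom quot.loc_lift_inj[OF iota_inj] quot_surj
  by (simp add: ring_iso_def bij_betw_def quot_field_def[of DD.P])

end

section \<open>The ultraproduct of the valuations\<close>

text \<open>Replaces a minimum by a disjunction, to which the ultrafilter rule for disjunctions
  applies.\<close>

lemma ole_omin_iff:
  assumes "tot_ordered_ab_group G" "x \<in> carrier G" "y \<in> carrier G" "z \<in> carrier G"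
  shows "ole G (omin G x y) z \<longleftrightarrow> ole G x z \<or> ole G y z"
  using assms unfolding tot_ordered_ab_group_def omin_def by (smt (verit))

locale max_ultrafilter_values = max_ultrafilter \<Lambda> D \<U>
  for \<Lambda> :: "'l set" and D :: "'l \<Rightarrow> ('a, 'm) ring_scheme" and \<U> +
  fixes \<Gamma> :: "'l \<times> 'a set \<Rightarrow> ('g, 'n) ogroup_scheme" and v
  assumes value_system: "is_value_system \<Lambda> D \<Gamma> v"
begin

lemma valuation_at: "p \<in> MaxU \<Longrightarrow> valuation (K (fst p)) (\<Gamma> p) (v p)"
  using value_system unfolding is_value_system_def by auto

text \<open>Unfolds the localization at \<open>M\<close> into equations \<open>y s = a\<close> with
  \<open>s\<close> outside \<open>M\<close>, the pointwise counterpart of the description of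
  fractions over \<open>R\<^sup>*\<close>.\<close>

lemma valuation_ring_at:
  assumes p: "p \<in> MaxU"
  shows "valuation_ring (K (fst p)) (\<Gamma> p) (v p) =
    {y \<in> carrier (K (fst p)). \<exists>a\<in>carrier (D (fst p)). \<exists>s\<in>carrier (D (fst p)) - snd p.
      y \<otimes>\<^bsub>K (fst p)\<^esub> to_quot (D (fst p)) s = to_quot (D (fst p)) a}"
proof -
  interpret D: domain "D (fst p)" using p by (rule domain_index)
  interpret K: field "K (fst p)" by (rule D.field_quot_field)
  interpret primeideal "snd p" "D (fst p)" using p by (rule primeideal)
  interpret localization_lift "D (fst p)" "carrier (D (fst p)) - snd p" "K (fst p)" "to_quot (D (fst p))"
  proof (intro localization_lift.intro localization_lift_axioms.intro domain_localization_max p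
      K.is_cring D.to_quot_hom subsetI)
    fix y assume "y \<in> to_quot (D (fst p)) ` (carrier (D (fst p)) - snd p)"
    then obtain s where s: "s \<in> carrier (D (fst p))" "s \<notin> snd p" "y = to_quot (D (fst p)) s"
      by blast
    then have "s \<noteq> \<zero>\<^bsub>D (fst p)\<^esub>" by auto
    with s show "y \<in> Units (K (fst p))"
      by (simp add: K.field_Units)
  qed
  have "valuation_ring (K (fst p)) (\<Gamma> p) (v p) =
      loc_lift (K (fst p)) (to_quot (D (fst p))) ` carrier (localization_at (D (fst p)) (snd p))"
    using value_system p unfolding is_value_system_def by auto
  then show ?thesis
    unfolding localization_at_def loc_lift_image .
qed

sublocale GG: ultraprod_group MaxU \<U> \<Gamma>
proof (intro ultraprod_group.intro ultraprod_group_axioms.intro M.ultrafilter_axioms)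
  show "tot_ordered_ab_group (\<Gamma> p)" if "p \<in> MaxU" for p
    using valuation_at[OF that] unfolding valuation_def by (elim conjE)
qed

abbreviation nonvanishing where
  "nonvanishing \<equiv> \<Pi>\<^sub>E l\<in>\<Lambda>. carrier (K l) - {\<zero>\<^bsub>K l\<^esub>}"

abbreviation V where
  "V \<equiv> ultra_val \<Lambda> D \<U> \<Gamma> v"

lemma nonvanishing_closed: "k \<in> nonvanishing \<Longrightarrow> k \<in> (\<Pi>\<^sub>E l\<in>\<Lambda>. carrier (K l))"
  by (auto simp: PiE_iff)

lemma nonvanishing_app:
  "\<lbrakk>k \<in> nonvanishing; l \<in> \<Lambda>\<rbrakk> \<Longrightarrow> k l \<in> carrier (K l) - {\<zero>\<^bsub>K l\<^esub>}"
  by (rule PiE_mem)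

lemma field_K: "l \<in> \<Lambda> \<Longrightarrow> field (K l)"
  by (rule domain.field_quot_field[OF domains])

lemma value_closed:
  "\<lbrakk>p \<in> MaxU; x \<in> carrier (K (fst p)) - {\<zero>\<^bsub>K (fst p)\<^esub>}\<rbrakk> \<Longrightarrow> v p x \<in> carrier (\<Gamma> p)"
  using valuation_at[of p] unfolding valuation_def by blast

lemma value_mult:
  "\<lbrakk>p \<in> MaxU; x \<in> carrier (K (fst p)) - {\<zero>\<^bsub>K (fst p)\<^esub>};
    y \<in> carrier (K (fst p)) - {\<zero>\<^bsub>K (fst p)\<^esub>}\<rbrakk> \<Longrightarrow>
    v p (x \<otimes>\<^bsub>K (fst p)\<^esub> y) = v p x \<otimes>\<^bsub>\<Gamma> p\<^esub> v p y"
  using valuation_at[of p] unfolding valuation_def by blast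

lemma value_add:
  assumes "p \<in> MaxU" "x \<in> carrier (K (fst p)) - {\<zero>\<^bsub>K (fst p)\<^esub>}"
    "y \<in> carrier (K (fst p)) - {\<zero>\<^bsub>K (fst p)\<^esub>}" "x \<oplus>\<^bsub>K (fst p)\<^esub> y \<noteq> \<zero>\<^bsub>K (fst p)\<^esub>"
  shows "ole (\<Gamma> p) (v p x) (v p (x \<oplus>\<^bsub>K (fst p)\<^esub> y)) \<or> ole (\<Gamma> p) (v p y) (v p (x \<oplus>\<^bsub>K (fst p)\<^esub> y))"
proof -
  interpret field "K (fst p)" using assms(1) by (intro field_K) simp
  have "ole (\<Gamma> p) (omin (\<Gamma> p) (v p x) (v p y)) (v p (x \<oplus>\<^bsub>K (fst p)\<^esub> y))"
    using valuation_at[OF assms(1)] assms(2-4) unfolding valuation_def by blast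
  then show ?thesis
    using ole_omin_iff[OF GG.groups[OF assms(1)]] value_closed[OF assms(1)] assms(2-4) by simp
qed

lemma val_class_eq: "val_class \<Lambda> D \<U> \<Gamma> v k = GG.cls (\<lambda>p\<in>MaxU. v p (k (fst p)))"
  by (simp add: val_class_def case_prod_unfold)

lemma value_PiE:
  "k \<in> nonvanishing \<Longrightarrow> (\<lambda>p\<in>MaxU. v p (k (fst p))) \<in> (\<Pi>\<^sub>E p\<in>MaxU. carrier (\<Gamma> p))"
  unfolding restrict_PiE_iff by (blast intro: value_closed nonvanishing_app fst_index)

lemma ultra_val_cls:
  assumes k: "k \<in> nonvanishing"
  shows "V (KK.cls k) = GG.cls (\<lambda>p\<in>MaxU. v p (k (fst p)))"
  unfolding ultra_val_def
proof (rule UN_const_eq)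
  show "{k' \<in> KK.cls k. \<forall>l\<in>\<Lambda>. k' l \<noteq> \<zero>\<^bsub>K l\<^esub>} \<noteq> {}"
    using pullback.I.ultra_class_self[OF nonvanishing_closed[OF k]] nonvanishing_app[OF k] by blast
  fix k' assume "k' \<in> {k' \<in> KK.cls k. \<forall>l\<in>\<Lambda>. k' l \<noteq> \<zero>\<^bsub>K l\<^esub>}"
  then have k': "k' \<in> nonvanishing" and ev: "\<forall>\<^sub>F p in ufilter MaxU \<U>. k (fst p) = k' (fst p)"
    using nonvanishing_closed[OF k]
    by (auto simp: pullback.I.mem_ultra_class_iff pullback.pull PiE_iff)
  show "val_class \<Lambda> D \<U> \<Gamma> v k' = GG.cls (\<lambda>p\<in>MaxU. v p (k (fst p)))"
    unfolding val_class_eq M.ultra_class_eq_iff[OF value_PiE[OF k'] value_PiE[OF k]]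
    using ev by eventually_elim simp
qed

lemma nonvanishing_rep:
  assumes k: "k \<in> (\<Pi>\<^sub>E l\<in>\<Lambda>. carrier (K l))" and nz: "KK.cls k \<noteq> \<zero>\<^bsub>KK.P\<^esub>"
  obtains k' where "k' \<in> nonvanishing" "KK.cls k = KK.cls k'"
    "\<forall>\<^sub>F p in ufilter MaxU \<U>. k (fst p) = k' (fst p)"
proof
  \<comment> \<open>The zeros of \<open>k\<close> form a negligible set of indices because its class
    is nonzero; there they are replaced by 1, so that a value in the group exists at every
    point.\<close>
  let ?k = "\<lambda>l\<in>\<Lambda>. if k l = \<zero>\<^bsub>K l\<^esub> then \<one>\<^bsub>K l\<^esub> else k l"
  show nv: "?k \<in> nonvanishing"
    unfolding restrict_PiE_iff
  proof
    fix l assume l: "l \<in> \<Lambda>"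
    interpret field "K l" using l by (rule field_K)
    show "(if k l = \<zero>\<^bsub>K l\<^esub> then \<one>\<^bsub>K l\<^esub> else k l) \<in> carrier (K l) - {\<zero>\<^bsub>K l\<^esub>}"
      using KK.app_closed[OF k l] by simp
  qed
  have "\<forall>\<^sub>F l in ufilter \<Lambda> \<F>. k l \<noteq> \<zero>\<^bsub>K l\<^esub>"
    using nz unfolding KK.cls_eq_zero_iff[OF k] pullback.I.not_eventually_iff .
  then have ev: "\<forall>\<^sub>F l in ufilter \<Lambda> \<F>. k l = ?k l"
    using pullback.I.eventually_index by eventually_elim simp
  then show "KK.cls k = KK.cls ?k"
    unfolding pullback.I.ultra_class_eq_iff[OF k nonvanishing_closed[OF nv]] .
  from ev show "\<forall>\<^sub>F p in ufilter MaxU \<U>. k (fst p) = ?k (fst p)"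
    unfolding pullback.pull .
qed

lemma K_star_nonzeroE:
  assumes "x \<in> carrier KK.P - {\<zero>\<^bsub>KK.P\<^esub>}"
  obtains k where "k \<in> nonvanishing" "x = KK.cls k"
  using assms by (auto elim!: KK.carrierE nonvanishing_rep)

lemma valuation_ultra_val: "valuation KK.P GG.P V"
  unfolding valuation_def
proof (intro conjI field_K_star GG.tot_ordered_ab_group_ultraprod funcsetI ballI impI)
  fix x assume x: "x \<in> carrier KK.P - {\<zero>\<^bsub>KK.P\<^esub>}"
  then obtain k where k: "k \<in> nonvanishing" "x = KK.cls k"
    by (rule K_star_nonzeroE)
  show "V x \<in> carrier GG.P"
    unfolding k(2) ultra_val_cls[OF k(1)] by (rule GG.cls_closed[OF value_PiE[OF k(1)]])
  fix y assume y: "y \<in> carrier KK.P - {\<zero>\<^bsub>KK.P\<^esub>}"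
  then obtain k' where k': "k' \<in> nonvanishing" "y = KK.cls k'"
    by (rule K_star_nonzeroE)
  note cl = nonvanishing_closed[OF k(1)] nonvanishing_closed[OF k'(1)]
  show "V (x \<otimes>\<^bsub>KK.P\<^esub> y) = V x \<otimes>\<^bsub>GG.P\<^esub> V y"
  proof -
    have nv: "(\<lambda>l\<in>\<Lambda>. k l \<otimes>\<^bsub>K l\<^esub> k' l) \<in> nonvanishing"
      unfolding restrict_PiE_iff
    proof
      fix l assume l: "l \<in> \<Lambda>"
      interpret field "K l" using l by (rule field_K)
      show "k l \<otimes>\<^bsub>K l\<^esub> k' l \<in> carrier (K l) - {\<zero>\<^bsub>K l\<^esub>}"
        using nonvanishing_app[OF k(1) l] nonvanishing_app[OF k'(1) l] by (simp add: integral_iff)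
    qed
    show ?thesis
      unfolding k(2) k'(2) KK.cls_mult[OF cl] ultra_val_cls[OF k(1)] ultra_val_cls[OF k'(1)]
        ultra_val_cls[OF nv] GG.cls_mult[OF value_PiE[OF k(1)] value_PiE[OF k'(1)]]
      by (intro arg_cong[where f = GG.cls] restrict_ext)
        (use value_mult nonvanishing_app[OF k(1)] nonvanishing_app[OF k'(1)] in simp)
  qed
  assume nz: "x \<oplus>\<^bsub>KK.P\<^esub> y \<noteq> \<zero>\<^bsub>KK.P\<^esub>"
  have "KK.cls (\<lambda>l\<in>\<Lambda>. k l \<oplus>\<^bsub>K l\<^esub> k' l) \<noteq> \<zero>\<^bsub>KK.P\<^esub>"
    using nz unfolding k(2) k'(2) KK.cls_add[OF cl] .
  \<comment> \<open>The sum of two nowhere vanishing representatives may vanish at some indices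
    although its class is nonzero, hence the change of representative.\<close>
  then obtain k'' where k'': "k'' \<in> nonvanishing"
    "KK.cls (\<lambda>l\<in>\<Lambda>. k l \<oplus>\<^bsub>K l\<^esub> k' l) = KK.cls k''"
    "\<forall>\<^sub>F p in ufilter MaxU \<U>. (\<lambda>l\<in>\<Lambda>. k l \<oplus>\<^bsub>K l\<^esub> k' l) (fst p) = k'' (fst p)"
    by (rule nonvanishing_rep[OF KK.restrict_add_PiE[OF cl]])
  let ?w = "\<lambda>k. \<lambda>p\<in>MaxU. v p (k (fst p))"
  \<comment> \<open>Which summand bounds the sum may depend on the point, so the disjunction is
    split only afterwards, by the ultrafilter.\<close>
  from k''(3) M.eventually_index
  have "\<forall>\<^sub>F p in ufilter MaxU \<U>. ole (\<Gamma> p) (?w k p) (?w k'' p) \<or> ole (\<Gamma> p) (?w k' p) (?w k'' p)"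
  proof eventually_elim
    case (elim p)
    then have "k'' (fst p) = k (fst p) \<oplus>\<^bsub>K (fst p)\<^esub> k' (fst p)" by simp
    with elim show ?case
      using value_add[of p "k (fst p)" "k' (fst p)"] nonvanishing_app[OF k(1), of "fst p"]
        nonvanishing_app[OF k'(1), of "fst p"] nonvanishing_app[OF k''(1), of "fst p"] by simp
  qed
  then have "ole GG.P (V x) (V (x \<oplus>\<^bsub>KK.P\<^esub> y)) \<or> ole GG.P (V y) (V (x \<oplus>\<^bsub>KK.P\<^esub> y))"
    unfolding k(2) k'(2) KK.cls_add[OF cl] k''(2) ultra_val_cls[OF k(1)] ultra_val_cls[OF k'(1)]
      ultra_val_cls[OF k''(1)] GG.cls_ole_iff[OF value_PiE[OF k(1)] value_PiE[OF k''(1)]]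
      GG.cls_ole_iff[OF value_PiE[OF k'(1)] value_PiE[OF k''(1)]] M.eventually_disj_iff .
  moreover have "V x \<in> carrier GG.P" "V y \<in> carrier GG.P" "V (x \<oplus>\<^bsub>KK.P\<^esub> y) \<in> carrier GG.P"
    unfolding k(2) k'(2) KK.cls_add[OF cl] k''(2) ultra_val_cls[OF k(1)] ultra_val_cls[OF k'(1)]
      ultra_val_cls[OF k''(1)]
    by (intro GG.cls_closed value_PiE k(1) k'(1) k''(1))+
  ultimately show "ole GG.P (omin GG.P (V x) (V y)) (V (x \<oplus>\<^bsub>KK.P\<^esub> y))"
    using ole_omin_iff[OF GG.tot_ordered_ab_group_ultraprod] by blast
qed

text \<open>Infinity forces the cases: a class is zero exactly when its representative vanishes at
  almost all points, and then both sides are decided by the infinite value. If both classes are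
  nonzero, the representatives are replaced by nowhere vanishing ones, for which the order on the
  ultraproduct is pointwise.\<close>

lemma ext_le_ultra_val_iff:
  assumes k: "k \<in> (\<Pi>\<^sub>E l\<in>\<Lambda>. carrier (K l))" and k': "k' \<in> (\<Pi>\<^sub>E l\<in>\<Lambda>. carrier (K l))"
  shows "ext_le GG.P (ext_val KK.P V (KK.cls k)) (ext_val KK.P V (KK.cls k')) \<longleftrightarrow>
    (\<forall>\<^sub>F p in ufilter MaxU \<U>. ext_le (\<Gamma> p)
      (ext_val (K (fst p)) (v p) (k (fst p))) (ext_val (K (fst p)) (v p) (k' (fst p))))"
    (is "?L \<longleftrightarrow> eventually ?Q _")
proof -
  have zero: "KK.cls f = \<zero>\<^bsub>KK.P\<^esub> \<longleftrightarrow> (\<forall>\<^sub>F p in ufilter MaxU \<U>. f (fst p) = \<zero>\<^bsub>K (fst p)\<^esub>)"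
    if "f \<in> (\<Pi>\<^sub>E l\<in>\<Lambda>. carrier (K l))" for f
    unfolding KK.cls_eq_zero_iff[OF that] pullback.pull ..
  consider "KK.cls k' = \<zero>\<^bsub>KK.P\<^esub>" | "KK.cls k' \<noteq> \<zero>\<^bsub>KK.P\<^esub>" "KK.cls k = \<zero>\<^bsub>KK.P\<^esub>"
    | "KK.cls k' \<noteq> \<zero>\<^bsub>KK.P\<^esub>" "KK.cls k \<noteq> \<zero>\<^bsub>KK.P\<^esub>"
    by blast
  then show ?thesis
  proof cases
    case 1
    then have "\<forall>\<^sub>F p in ufilter MaxU \<U>. k' (fst p) = \<zero>\<^bsub>K (fst p)\<^esub>"
      unfolding zero[OF k'] .
    then have "eventually ?Q (ufilter MaxU \<U>)"
      by eventually_elim (simp add: ext_val_def)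
    with 1 show ?thesis by (simp add: ext_val_def)
  next
    case 2
    then have "\<forall>\<^sub>F p in ufilter MaxU \<U>. k' (fst p) \<noteq> \<zero>\<^bsub>K (fst p)\<^esub>"
      "\<forall>\<^sub>F p in ufilter MaxU \<U>. k (fst p) = \<zero>\<^bsub>K (fst p)\<^esub>"
      unfolding zero[OF k'] zero[OF k] M.not_eventually_iff .
    then have "\<forall>\<^sub>F p in ufilter MaxU \<U>. \<not> ?Q p"
      by eventually_elim (simp add: ext_val_def)
    then have "\<not> eventually ?Q (ufilter MaxU \<U>)"
      unfolding M.not_eventually_iff .
    with 2 show ?thesis by (simp add: ext_val_def)
  next
    case 3
    obtain h where h: "h \<in> nonvanishing" "KK.cls k = KK.cls h"
      and ev: "\<forall>\<^sub>F p in ufilter MaxU \<U>. k (fst p) = h (fst p)"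
      using k 3(2) by (rule nonvanishing_rep)
    obtain h' where h': "h' \<in> nonvanishing" "KK.cls k' = KK.cls h'"
      and ev': "\<forall>\<^sub>F p in ufilter MaxU \<U>. k' (fst p) = h' (fst p)"
      using k' 3(1) by (rule nonvanishing_rep)
    have "?L \<longleftrightarrow> ole GG.P (V (KK.cls h)) (V (KK.cls h'))"
      using 3 by (simp add: ext_val_def h(2) h'(2))
    also have "\<dots> \<longleftrightarrow> (\<forall>\<^sub>F p in ufilter MaxU \<U>. ole (\<Gamma> p)
        ((\<lambda>p\<in>MaxU. v p (h (fst p))) p) ((\<lambda>p\<in>MaxU. v p (h' (fst p))) p))"
      unfolding ultra_val_cls[OF h(1)] ultra_val_cls[OF h'(1)]
      by (rule GG.cls_ole_iff[OF value_PiE[OF h(1)] value_PiE[OF h'(1)]])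
    also have "\<dots> \<longleftrightarrow> eventually ?Q (ufilter MaxU \<U>)"
    proof (rule eventually_subst)
      from ev ev' M.eventually_index
      show "\<forall>\<^sub>F p in ufilter MaxU \<U>. ole (\<Gamma> p) ((\<lambda>p\<in>MaxU. v p (h (fst p))) p)
          ((\<lambda>p\<in>MaxU. v p (h' (fst p))) p) \<longleftrightarrow> ?Q p"
      proof eventually_elim
        case (elim p)
        then show ?case
          using nonvanishing_app[OF h(1), of "fst p"] nonvanishing_app[OF h'(1), of "fst p"]
          by (simp add: ext_val_def)
      qed
    qed
    finally show ?thesis .
  qed
qed

section \<open>The valuation ring as a localization of \<open>R\<^sup>*\<close>\<close>

lemma cls_mem_valuation_ring_iff:
  assumes k: "k \<in> (\<Pi>\<^sub>E l\<in>\<Lambda>. carrier (K l))"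
  shows "KK.cls k \<in> valuation_ring KK.P GG.P V \<longleftrightarrow>
    (\<forall>\<^sub>F p in ufilter MaxU \<U>. k (fst p) \<in> valuation_ring (K (fst p)) (\<Gamma> p) (v p))"
proof -
  have "KK.cls k \<in> valuation_ring KK.P GG.P V \<longleftrightarrow>
      ext_le GG.P (ext_val KK.P V \<one>\<^bsub>KK.P\<^esub>) (ext_val KK.P V (KK.cls k))"
    using KK.cls_closed[OF k] by (simp add: mem_valuation_ring_iff[OF valuation_ultra_val])
  also have "\<dots> \<longleftrightarrow> (\<forall>\<^sub>F p in ufilter MaxU \<U>. ext_le (\<Gamma> p)
      (ext_val (K (fst p)) (v p) ((\<lambda>l\<in>\<Lambda>. \<one>\<^bsub>K l\<^esub>) (fst p))) (ext_val (K (fst p)) (v p) (k (fst p))))"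
    unfolding KK.one_eq by (rule ext_le_ultra_val_iff[OF KK.restrict_one_PiE k])
  also have "\<dots> \<longleftrightarrow>
      (\<forall>\<^sub>F p in ufilter MaxU \<U>. k (fst p) \<in> valuation_ring (K (fst p)) (\<Gamma> p) (v p))"
    by (rule M.eventually_cong_index)
      (simp add: mem_valuation_ring_iff[OF valuation_at] KK.app_closed[OF k])
  finally show ?thesis .
qed

lemma loc_image:
  assumes pruefer: "\<And>l. l \<in> \<Lambda> \<Longrightarrow> pruefer_domain (D l)"
  shows "loc_lift KK.P (K_embed \<Lambda> D \<U>) ` carrier (localization DD.P denominators) =
    valuation_ring KK.P GG.P V"
proof (intro equalityI subsetI)
  fix x assume "x \<in> loc_lift KK.P (K_embed \<Lambda> D \<U>) ` carrier (localization DD.P denominators)"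
  then obtain y s where x: "x \<in> carrier KK.P" and y: "y \<in> carrier DD.P" and s: "s \<in> denominators"
    and eq: "x \<otimes>\<^bsub>KK.P\<^esub> K_embed \<Lambda> D \<U> s = K_embed \<Lambda> D \<U> y"
    unfolding loc.loc_lift_image by blast
  obtain k where k: "k \<in> (\<Pi>\<^sub>E l\<in>\<Lambda>. carrier (K l))" "x = KK.cls k"
    using x by (rule KK.carrierE)
  obtain a where a: "a \<in> (\<Pi>\<^sub>E l\<in>\<Lambda>. carrier (D l))" "y = DD.cls a"
    using y by (rule DD.carrierE)
  obtain b where b: "b \<in> (\<Pi>\<^sub>E l\<in>\<Lambda>. carrier (D l))" "s = DD.cls b"
    and b_notin: "\<forall>\<^sub>F p in ufilter MaxU \<U>. b (fst p) \<notin> snd p"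
    using s by (rule denE)
  have "\<forall>\<^sub>F p in ufilter MaxU \<U>. k (fst p) \<otimes>\<^bsub>K (fst p)\<^esub> to_quot (D (fst p)) (b (fst p)) =
      to_quot (D (fst p)) (a (fst p))"
    using eq unfolding k(2) a(2) b(2) iota_mult_eq_iff[OF k(1) a(1) b(1)] pullback.pull .
  from this b_notin M.eventually_index
  have "\<forall>\<^sub>F p in ufilter MaxU \<U>. k (fst p) \<in> valuation_ring (K (fst p)) (\<Gamma> p) (v p)"
  proof eventually_elim
    case (elim p)
    then show ?case
      unfolding valuation_ring_at[OF elim(3)]
      using KK.app_closed[OF k(1), of "fst p"] DD.app_closed[OF a(1), of "fst p"]
        DD.app_closed[OF b(1), of "fst p"] by auto
  qed
  then show "x \<in> valuation_ring KK.P GG.P V"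
    unfolding k(2) cls_mem_valuation_ring_iff[OF k(1)] .
next
  fix x assume x: "x \<in> valuation_ring KK.P GG.P V"
  then have x_closed: "x \<in> carrier KK.P"
    unfolding valuation_ring_def by blast
  then obtain k where k: "k \<in> (\<Pi>\<^sub>E l\<in>\<Lambda>. carrier (K l))" "x = KK.cls k"
    by (rule KK.carrierE)
  \<comment> \<open>The choice is made over the index \<open>l\<close>, before any maximal ideal is
    considered, so the four families represent elements of \<open>R\<^sup>*\<close>.\<close>
  have "\<exists>p q r s. p \<in> carrier (D l) \<and> q \<in> carrier (D l) \<and> r \<in> carrier (D l) \<and> s \<in> carrier (D l) \<and>
      k l \<otimes>\<^bsub>K l\<^esub> to_quot (D l) q = to_quot (D l) p \<and>
      k l \<otimes>\<^bsub>K l\<^esub> to_quot (D l) s = to_quot (D l) r \<and> p \<oplus>\<^bsub>D l\<^esub> s = \<one>\<^bsub>D l\<^esub>"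
    if "l \<in> \<Lambda>" for l
    by (rule domain.pruefer_fractions[OF domains[OF that] pruefer[OF that] KK.app_closed[OF k(1) that]])
      blast
  then obtain p q r s where pqrs: "\<And>l. l \<in> \<Lambda> \<Longrightarrow>
      p l \<in> carrier (D l) \<and> q l \<in> carrier (D l) \<and> r l \<in> carrier (D l) \<and> s l \<in> carrier (D l) \<and>
      k l \<otimes>\<^bsub>K l\<^esub> to_quot (D l) (q l) = to_quot (D l) (p l) \<and>
      k l \<otimes>\<^bsub>K l\<^esub> to_quot (D l) (s l) = to_quot (D l) (r l) \<and> p l \<oplus>\<^bsub>D l\<^esub> s l = \<one>\<^bsub>D l\<^esub>"
    by metis
  \<comment> \<open>Stated for an arbitrary pair of families, since it will be applied either to
    \<open>p\<close>, \<open>q\<close> or to \<open>r\<close>, \<open>s\<close>.\<close>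
  have mem: "x \<in> loc_lift KK.P (K_embed \<Lambda> D \<U>) ` carrier (localization DD.P denominators)"
    if a: "\<And>l. l \<in> \<Lambda> \<Longrightarrow> a l \<in> carrier (D l)" and b: "\<And>l. l \<in> \<Lambda> \<Longrightarrow> b l \<in> carrier (D l)"
      and eq: "\<And>l. l \<in> \<Lambda> \<Longrightarrow> k l \<otimes>\<^bsub>K l\<^esub> to_quot (D l) (b l) = to_quot (D l) (a l)"
      and b_notin: "\<forall>\<^sub>F p in ufilter MaxU \<U>. b (fst p) \<notin> snd p" for a b
  proof -
    have PiE: "restrict a \<Lambda> \<in> (\<Pi>\<^sub>E l\<in>\<Lambda>. carrier (D l))" "restrict b \<Lambda> \<in> (\<Pi>\<^sub>E l\<in>\<Lambda>. carrier (D l))"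
      using a b by (simp_all add: restrict_PiE_iff)
    from b_notin M.eventually_index
    have "\<forall>\<^sub>F p in ufilter MaxU \<U>. restrict b \<Lambda> (fst p) \<notin> snd p"
      by eventually_elim simp
    then have b_mem: "DD.cls (restrict b \<Lambda>) \<in> denominators"
      unfolding cls_mem_den_iff[OF PiE(2)] .
    have "x \<otimes>\<^bsub>KK.P\<^esub> K_embed \<Lambda> D \<U> (DD.cls (restrict b \<Lambda>)) = K_embed \<Lambda> D \<U> (DD.cls (restrict a \<Lambda>))"
      unfolding k(2) iota_mult_eq_iff[OF k(1) PiE] by (rule pullback.I.eventuallyI) (simp add: eq)
    then show ?thesis
      by (rule loc.loc_lift_imageI[OF x_closed DD.cls_closed[OF PiE(1)] b_mem])
  qed
  have "\<forall>\<^sub>F P in ufilter MaxU \<U>. k (fst P) \<in> valuation_ring (K (fst P)) (\<Gamma> P) (v P)"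
    using x unfolding k(2) cls_mem_valuation_ring_iff[OF k(1)] .
  then have "\<forall>\<^sub>F P in ufilter MaxU \<U>. q (fst P) \<notin> snd P \<or> s (fst P) \<notin> snd P"
    using M.eventually_index
  proof eventually_elim
    case (elim P)
    \<comment> \<open>This fraction may vary with the maximal ideal; it only serves to exclude that
      both \<open>q\<close> and \<open>s\<close> lie in it.\<close>
    then obtain c u where "c \<in> carrier (D (fst P))" "u \<in> carrier (D (fst P))" "u \<notin> snd P"
      "k (fst P) \<otimes>\<^bsub>K (fst P)\<^esub> to_quot (D (fst P)) u = to_quot (D (fst P)) c"
      unfolding valuation_ring_at[OF elim(2)] by blast
    then show ?case
      using domain.pruefer_denominator[OF domain_index primeideal, of P "k (fst P)"
          "p (fst P)" "q (fst P)" "s (fst P)" c u]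
        KK.app_closed[OF k(1), of "fst P"] pqrs[of "fst P"] elim(2) by simp
  qed
  \<comment> \<open>The ultrafilter makes one of the two alternatives hold at almost all points,
    uniformly, and \<open>mem\<close> applies to the corresponding fraction.\<close>
  then show "x \<in> loc_lift KK.P (K_embed \<Lambda> D \<U>) ` carrier (localization DD.P denominators)"
    unfolding M.eventually_disj_iff using mem[of p q] mem[of r s] pqrs by blast
qed

lemma loc_iso:
  assumes "\<And>l. l \<in> \<Lambda> \<Longrightarrow> pruefer_domain (D l)"
  shows "loc_lift KK.P (K_embed \<Lambda> D \<U>) \<in>
    ring_iso (localization DD.P denominators) (KK.P\<lparr>carrier := valuation_ring KK.P GG.P V\<rparr>)"
proof -
  have bij: "bij_betw (loc_lift KK.P (K_embed \<Lambda> D \<U>)) (carrier (localization DD.P denominators))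
      (valuation_ring KK.P GG.P V)"
    using loc.loc_lift_inj[OF iota_inj] loc_image[OF assms] by (simp add: bij_betw_def)
  show ?thesis
    using loc.loc_lift_hom bij bij_betwE[OF bij] by (auto simp: ring_iso_def ring_hom_def)
qed

lemma ext_le_iota_iff:
  assumes a: "a \<in> (\<Pi>\<^sub>E l\<in>\<Lambda>. carrier (D l))" and b: "b \<in> (\<Pi>\<^sub>E l\<in>\<Lambda>. carrier (D l))"
  shows "ext_le GG.P (ext_val KK.P V (K_embed \<Lambda> D \<U> (DD.cls b)))
      (ext_val KK.P V (K_embed \<Lambda> D \<U> (DD.cls a))) \<longleftrightarrow>
    {(l, M) \<in> MaxU. ext_le (\<Gamma> (l, M)) (ext_val (K l) (v (l, M)) (to_quot (D l) (b l)))
      (ext_val (K l) (v (l, M)) (to_quot (D l) (a l)))} \<in> \<U>"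
proof -
  have "{(l, M) \<in> MaxU. ext_le (\<Gamma> (l, M)) (ext_val (K l) (v (l, M)) (to_quot (D l) (b l)))
        (ext_val (K l) (v (l, M)) (to_quot (D l) (a l)))} =
      {p \<in> MaxU. ext_le (\<Gamma> p)
        (ext_val (K (fst p)) (v p) ((\<lambda>l\<in>\<Lambda>. to_quot (D l) (b l)) (fst p)))
        (ext_val (K (fst p)) (v p) ((\<lambda>l\<in>\<Lambda>. to_quot (D l) (a l)) (fst p)))}"
    by (auto dest: fst_index)
  then show ?thesis
    unfolding iota.map_cls[OF a] iota.map_cls[OF b]
      ext_le_ultra_val_iff[OF iota.map_PiE[OF b] iota.map_PiE[OF a]] M.eventually_iff by simp
qed

end

text \<open>That the extension is canonical is expressed by uniqueness: denominators go to units,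
  \<open>\<psi>\<close> restricts to \<open>\<phi>\<close>, and no other homomorphism on the
  localization does. The identifications inside \<open>K\<^sup>*\<close> are expressed by requiring
  the map \<open>loc_lift Ks \<iota>\<close> induced by the embedding, rather than some unspecified
  map, to be an isomorphism.\<close>

theorem proposition3p3:
  fixes \<Lambda> :: "'l set"
    and D :: "'l \<Rightarrow> 'a ring"
    and \<U> :: "('l \<times> 'a set) set set"
    and \<Gamma> :: "'l \<times> 'a set \<Rightarrow> 'g ogroup"
    and vM :: "'l \<times> 'a set \<Rightarrow> ('a \<times> 'a) set \<Rightarrow> 'g"
  defines "MaxU \<equiv> max_union \<Lambda> D"
    and "R \<equiv> (\<Pi>\<^sub>E l\<in>\<Lambda>. carrier (D l))"
    and "Rs \<equiv> R_star \<Lambda> D \<U>"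
    and "RsU \<equiv> R_star_loc \<Lambda> D \<U>"
    and "den \<equiv> carrier (R_star \<Lambda> D \<U>) - star \<Lambda> D \<U> ` ultra_ideal \<Lambda> D \<U>"
    and "L \<equiv> loc_ultraprod \<Lambda> D \<U>"
    and "\<phi> \<equiv> loc_map \<Lambda> D \<U>"
    and "\<psi> \<equiv> loc_lift (loc_ultraprod \<Lambda> D \<U>) (loc_map \<Lambda> D \<U>)"
    and "Ks \<equiv> K_star \<Lambda> D \<U>"
    and "\<iota> \<equiv> K_embed \<Lambda> D \<U>"
    and "\<Gamma>U \<equiv> ultraprod_ogroup (max_union \<Lambda> D) \<U> \<Gamma>"
    and "v \<equiv> ultra_val \<Lambda> D \<U> \<Gamma> vM"
  assumes pruefer: "\<And>l. l \<in> \<Lambda> \<Longrightarrow> pruefer_domain (D l)"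
    and ultra: "ultrafilter_on MaxU \<U>"
    and value_groups: "is_value_system \<Lambda> D \<Gamma> vM"
  shows
    \<comment> \<open>(1)\<close>
    "((\<forall>r\<in>R. \<phi> (star \<Lambda> D \<U> r) = loc_class \<Lambda> D \<U> r) \<and>
      \<phi> \<in> ring_hom Rs L \<and> inj_on \<phi> (carrier Rs) \<and>
      \<phi> ` den \<subseteq> Units L \<and>
      \<psi> \<in> ring_hom RsU L \<and> inj_on \<psi> (carrier RsU) \<and>
      (\<forall>x\<in>carrier Rs. \<psi> (fraction Rs den x \<one>\<^bsub>Rs\<^esub>) = \<phi> x) \<and>
      (\<forall>\<psi>'\<in>ring_hom RsU L. (\<forall>x\<in>carrier Rs. \<psi>' (fraction Rs den x \<one>\<^bsub>Rs\<^esub>) = \<phi> x)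
          \<longrightarrow> (\<forall>y\<in>carrier RsU. \<psi>' y = \<psi> y)))
     \<and>
     \<comment> \<open>(2)\<close>
     (loc_lift Ks \<iota> \<in> ring_iso (quot_field Rs) Ks \<and>
      (\<forall>k\<in>(\<Pi>\<^sub>E l\<in>\<Lambda>. carrier (quot_field (D l)) - {\<zero>\<^bsub>quot_field (D l)\<^esub>}).
          v (K_class \<Lambda> D \<U> k) = val_class \<Lambda> D \<U> \<Gamma> vM k) \<and>
      valuation Ks \<Gamma>U v \<and>
      loc_lift Ks \<iota> \<in> ring_iso RsU (Ks\<lparr>carrier := valuation_ring Ks \<Gamma>U v\<rparr>))
     \<and>
     \<comment> \<open>(3)\<close>
     (\<forall>a\<in>R. \<forall>b\<in>R.
        ext_le \<Gamma>U (ext_val Ks v (\<iota> (star \<Lambda> D \<U> b))) (ext_val Ks v (\<iota> (star \<Lambda> D \<U> a)))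
        \<longleftrightarrow>
        {(l, M) \<in> MaxU.
           ext_le (\<Gamma> (l, M))
             (ext_val (quot_field (D l)) (vM (l, M)) (to_quot (D l) (b l)))
             (ext_val (quot_field (D l)) (vM (l, M)) (to_quot (D l) (a l)))} \<in> \<U>)"
proof -
  interpret max_ultrafilter_values \<Lambda> D \<U> \<Gamma> vM
  proof (intro max_ultrafilter_values.intro max_ultrafilter.intro ultrafilter.intro
      max_ultrafilter_axioms.intro max_ultrafilter_values_axioms.intro value_groups)
    show "ultrafilter_on (max_union \<Lambda> D) \<U>"
      using ultra unfolding MaxU_def .
    show "domain (D l)" if "l \<in> \<Lambda>" for l
      using pruefer[OF that] unfolding pruefer_domain_def by blast
  qed
  have RsU: "R_star_loc \<Lambda> D \<U> = localization DD.P denominators"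
    by (simp add: R_star_loc_def R_star_def localization_at_def)
  have phi_star: "loc_map \<Lambda> D \<U> (star \<Lambda> D \<U> r) = loc_class \<Lambda> D \<U> r"
    if "r \<in> (\<Pi>\<^sub>E l\<in>\<Lambda>. carrier (D l))" for r
    unfolding star_def phi.map_cls[OF that] loc_class_eq ..
  have v_class: "ultra_val \<Lambda> D \<U> \<Gamma> vM (K_class \<Lambda> D \<U> k) = val_class \<Lambda> D \<U> \<Gamma> vM k"
    if "k \<in> nonvanishing" for k
    unfolding K_class_def val_class_eq by (rule ultra_val_cls[OF that])
  show ?thesis
    unfolding MaxU_def R_def Rs_def RsU_def den_def L_def \<phi>_def \<psi>_def Ks_def \<iota>_def \<Gamma>U_def v_def
      RsU R_star_def loc_ultraprod_def K_star_def
  proof (intro conjI ballI impI)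
    show "loc_map \<Lambda> D \<U> (star \<Lambda> D \<U> r) = loc_class \<Lambda> D \<U> r"
      if "r \<in> (\<Pi>\<^sub>E l\<in>\<Lambda>. carrier (D l))" for r
      by (rule phi_star[OF that])
    show "ultra_val \<Lambda> D \<U> \<Gamma> vM (K_class \<Lambda> D \<U> k) = val_class \<Lambda> D \<U> \<Gamma> vM k"
      if "k \<in> nonvanishing" for k
      by (rule v_class[OF that])
    show "loc_lift LL.P (loc_map \<Lambda> D \<U>) (fraction DD.P denominators x \<one>\<^bsub>DD.P\<^esub>) = loc_map \<Lambda> D \<U> x"
      if "x \<in> carrier DD.P" for x
      by (rule psi.loc_lift_of[OF that])
    show "\<psi>' y = loc_lift LL.P (loc_map \<Lambda> D \<U>) y"
      if "\<psi>' \<in> ring_hom (localization DD.P denominators) LL.P"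
        "\<forall>x\<in>carrier DD.P. \<psi>' (fraction DD.P denominators x \<one>\<^bsub>DD.P\<^esub>) = loc_map \<Lambda> D \<U> x"
        "y \<in> carrier (localization DD.P denominators)" for \<psi>' y
      by (rule psi.loc_lift_unique[OF that(1) bspec[OF that(2)] that(3)])
    show "ext_le GG.P (ext_val KK.P V (K_embed \<Lambda> D \<U> (star \<Lambda> D \<U> b)))
        (ext_val KK.P V (K_embed \<Lambda> D \<U> (star \<Lambda> D \<U> a))) \<longleftrightarrow>
      {(l, M) \<in> max_union \<Lambda> D. ext_le (\<Gamma> (l, M))
        (ext_val (K l) (vM (l, M)) (to_quot (D l) (b l)))
        (ext_val (K l) (vM (l, M)) (to_quot (D l) (a l)))} \<in> \<U>"
      if "a \<in> (\<Pi>\<^sub>E l\<in>\<Lambda>. carrier (D l))" "b \<in> (\<Pi>\<^sub>E l\<in>\<Lambda>. carrier (D l))" for a b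
      unfolding star_def by (rule ext_le_iota_iff[OF that])
    show "loc_lift KK.P (K_embed \<Lambda> D \<U>) \<in>
        ring_iso (localization DD.P denominators) (KK.P\<lparr>carrier := valuation_ring KK.P GG.P V\<rparr>)"
      by (rule loc_iso) (rule pruefer)
  qed (fact phi.map_hom phi_inj psi.denoms_Units psi.loc_lift_hom psi.loc_lift_inj[OF phi_inj]
      quot_iso valuation_ultra_val)+
qed

end
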